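(* For any $n\in\mathbb Z$, $$\overline{L}_n\phi_+(z)=\phi_+'(z)\left(\left[\left(z^{-2}\frac{\phi_+(z)^{n+1}}{\phi_+'(z)}\right)^*\right]_{++}-\frac12z\left(\left(\frac{\phi_+(z)^{n+1}}{\phi_+'(z)}\right)_1\right)^*\right).$$
   Context: $\mathrm{Loop}^1(\mathbb C\setminus\{0\})$ is the set of compact subsets $\gamma\subset\mathbb C\setminus\{0\}$ homeomorphic to $S^1$ which surround $0$. For such $\gamma$ let $U_+\ni0$ be the bounded component of $\mathbb C\setminus\gamma$ and let $\phi_+:(\Delta,0)\to(U_+,0)$, $\Delta=\{|z|<1\}$, be the conformal isomorphism normalized by $\phi_+(0)=0$, $\phi_+'(0)>0$. For fixed $z$, $\phi_+(z)$ is a function of $\gamma$. For a holomorphic function $v$ on $\mathbb C\setminus\{0\}$ with finite Laurent expansion let $\overset{\rightarrow}{v}=v_1\partial_x+v_2\partial_y$, $v=v_1+iv_2$, be the corresponding real vector field. It acts on functions $F$ of $\gamma$ by $(\pi_0(\overset{\rightarrow}{v})F)(\gamma)=\frac{d}{dt}\big|_{t=0}F(\exp(-t\overset{\rightarrow}{v})(\gamma))$, where $\exp(t\overset{\rightarrow}{v})$ is the flow. Let $\overset{\rightarrow}{L}_n$, $\overset{\longrightarrow}{iL}_n$ correspond to $v(z)=-z^{n+1}$, $v(z)=-iz^{n+1}$. Here $\overline L_n$ denotes the operator $\overline\pi(\overline L_n)=\frac12\left(\pi_0(\overset{\rightarrow}{L}_n)+i\pi_0(\overset{\longrightarrow}{iL}_n)\right)$,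 acting pointwise in $z$ on $\phi_+$. For a Laurent expansion $f(z)=\sum_kf_kz^k$ at $z=0$: $(f)_k=f_k$ is the $k$th coefficient; $f^*(z)=\sum_k\overline{f_k}\,z^{-k}$ (formal Laurent series); $f_{++}(z)=\sum_{k>0}f_kz^k$. For a complex number $c$, $c^*$ is its complex conjugate. *)

theory Defs
  imports "HOL-Complex_Analysis.Complex_Analysis"
begin

definition Loop1 :: "complex set set" where
  "Loop1 = {\<gamma>. compact \<gamma> \<and> \<gamma> \<subseteq> - {0} \<and> \<gamma> homeomorphic (sphere (0::complex) 1) \<and> 0 \<in> inside \<gamma>}"

(* For a Jordan curve \<gamma>, the set "inside \<gamma>" is the bounded component of the complement. *)
definition is_phi_plus :: "complex set \<Rightarrow> (complex \<Rightarrow> complex) \<Rightarrow> bool" where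
  "is_phi_plus \<gamma> f \<longleftrightarrow>
     f holomorphic_on ball 0 1 \<and> bij_betw f (ball 0 1) (inside \<gamma>) \<and>
     f 0 = 0 \<and> deriv f 0 \<in> \<real> \<and> 0 < Re (deriv f 0)"

(* The normalization determines the function on the unit disc only; its values elsewhere are
   arbitrary. *)
definition phi_plus :: "complex set \<Rightarrow> complex \<Rightarrow> complex" where
  "phi_plus \<gamma> = (SOME f. is_phi_plus \<gamma> f)"

(* A function v on the punctured plane is read as the real vector field with components Re v, Im v,
   so that x' = v(x) is the equation of its integral curves. *)
definition integral_curve :: "(complex \<Rightarrow> complex) \<Rightarrow> (real \<Rightarrow> complex) \<Rightarrow> real set \<Rightarrow> bool" where
  "integral_curve v x I \<longleftrightarrow>
     (\<forall>s\<in>I. x s \<noteq> 0 \<and> (x has_vector_derivative v (x s)) (at s within I))"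

(* The local flow exp(t v) in the punctured plane. It is meaningful at p only if the integral curve
   starting at p exists up to time t; on a compact set this holds for all small t. *)
definition flow :: "(complex \<Rightarrow> complex) \<Rightarrow> real \<Rightarrow> complex \<Rightarrow> complex" where
  "flow v t p = (THE q. \<exists>x. integral_curve v x (closed_segment 0 t) \<and> x 0 = p \<and> x t = q)"

definition pi0_differentiable ::
    "(complex \<Rightarrow> complex) \<Rightarrow> (complex set \<Rightarrow> complex) \<Rightarrow> complex set \<Rightarrow> bool" where
  "pi0_differentiable v F \<gamma> \<longleftrightarrow> (\<lambda>t::real. F (flow v (-t) ` \<gamma>)) differentiable (at 0)"

definition pi0 :: "(complex \<Rightarrow> complex) \<Rightarrow> (complex set \<Rightarrow> complex) \<Rightarrow> complex set \<Rightarrow> complex" where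
  "pi0 v F \<gamma> = vector_derivative (\<lambda>t::real. F (flow v (-t) ` \<gamma>)) (at 0)"

definition vf_L :: "int \<Rightarrow> complex \<Rightarrow> complex" where
  "vf_L n z = - (z powi (n + 1))"

definition vf_iL :: "int \<Rightarrow> complex \<Rightarrow> complex" where
  "vf_iL n z = - (\<i> * z powi (n + 1))"

definition L_bar :: "int \<Rightarrow> (complex set \<Rightarrow> complex) \<Rightarrow> complex set \<Rightarrow> complex" where
  "L_bar n F \<gamma> = (pi0 (vf_L n) F \<gamma> + \<i> * pi0 (vf_iL n) F \<gamma>) / 2"

(* Formal Laurent series, possibly infinite in both directions, are given by their coefficient
   functions on the integers: the star operation below turns a series with finite principal part
   into one that is in general infinite in the negative direction. *)
definition laurent_coeffs :: "(complex \<Rightarrow> complex) \<Rightarrow> int \<Rightarrow> complex" where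
  "laurent_coeffs f = fls_nth (laurent_expansion f 0)"

definition laurent_star :: "(int \<Rightarrow> complex) \<Rightarrow> int \<Rightarrow> complex" where
  "laurent_star a = (\<lambda>k. cnj (a (-k)))"

definition pos_part :: "(int \<Rightarrow> complex) \<Rightarrow> int \<Rightarrow> complex" where
  "pos_part a = (\<lambda>k. if k > 0 then a k else 0)"

(* If f is meromorphic at 0, then pos_part (laurent_star (laurent_coeffs f)) has finite support,
   so the sum is a polynomial there. *)
definition laurent_eval :: "(int \<Rightarrow> complex) \<Rightarrow> complex \<Rightarrow> complex" where
  "laurent_eval a z = (\<Sum>\<^sub>\<infinity>k. a k * z powi k)"

end

(* The flow of - c z^(n+1) is explicit, since z^(-n) is affine in time. Pull the field back to the
   disc: c phi^(n+1) / phi' = z beta - z q, where q is a Laurent polynomial which is purely imaginary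
   on the unit circle (so that z q is tangent to the circle; it absorbs the principal part at 0) and
   beta is holomorphic on the disc with beta(0) real. Then F_t(z) = flow_t (phi (z exp (t q(z))))
   parametrizes a collar of the moved curve and P_t(z) = phi (z exp (t beta(z))) a compact part of the
   moved domain, and they differ by O(t^2) on their common annulus. The logarithmic moduli of
   phi_t^-1 (F_t(z)) / z and phi_t^-1 (P_t(z)) / z are estimated by the three circles theorem and by
   the maximum principle; as the former theorem contracts, both are O(t^2), and Borel-Caratheodory
   gives phi_t = P_t + O(t^2) inside the disc. Hence the derivative of phi_t(z) is phi'(z) z beta(z). *)
theory Submission
  imports Defs
begin

section \<open>Maximum principles\<close>

text \<open>No regularity of the curve is assumed, so the Riemann map need not extend smoothly to
  the circle and a variational formula through boundary values is out of reach. The moved domain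
  cannot be parametrized by the flow alone, since the field may be singular at 0, nor by
  \<open>P\<close> alone, since \<beta> contains the inverse of the derivative of the Riemann map,
  which is uncontrolled near the circle. Hence two maps: \<open>F\<close> is good up to the curve,
  because a tangent displacement preserves the disc, and \<open>P\<close> is good across 0. Each
  estimate needs the other one as boundary data, and only the factor ln \<rho>2 / ln \<rho>1 < 1
  gained between two fixed circles closes the loop of inequalities. Moduli determine a map up to
  rotation; positive derivatives at 0 remove this freedom. The resulting derivative is real linear
  but not complex linear in c, and combining c = 1 with c = \<i> as in \<open>L_bar\<close> extracts
  the antilinear part: conjugated coefficients remain, and the rotation that makes \<beta> real at 0
  is responsible for the half.\<close>

lemma frontier_annulus_subset:
  "frontier {z::complex. a \<le> norm z \<and> norm z \<le> b} \<subseteq> {z. norm z = a \<or> norm z = b}"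
proof -
  have "closed {z::complex. a \<le> norm z \<and> norm z \<le> b}"
    by (intro closed_Collect_conj closed_Collect_le continuous_intros)
  moreover have "open {z::complex. a < norm z \<and> norm z < b}"
    by (intro open_Collect_conj open_Collect_less continuous_intros)
  then have "{z::complex. a < norm z \<and> norm z < b} \<subseteq> interior {z. a \<le> norm z \<and> norm z \<le> b}"
    by (intro interior_maximal) auto
  ultimately show ?thesis
    by (force simp: frontier_def)
qed

lemma maximum_modulus_annulus:
  fixes f :: "complex \<Rightarrow> complex"
  assumes hol: "f holomorphic_on {z. r < norm z \<and> norm z < R}" and r: "r < a" "b < R"
    and B: "\<And>z. norm z = a \<or> norm z = b \<Longrightarrow> norm (f z) \<le> B"
    and z: "a \<le> norm z" "norm z \<le> b"
  shows "norm (f z) \<le> B"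
proof -
  define S where "S = {z::complex. a \<le> norm z \<and> norm z \<le> b}"
  have cl: "closure S = S"
    unfolding S_def closure_eq
    by (intro closed_Collect_conj closed_Collect_le continuous_intros)
  have sub: "S \<subseteq> {z. r < norm z \<and> norm z < R}"
    using r by (auto simp: S_def)
  have "f holomorphic_on interior S"
    by (rule holomorphic_on_subset[OF hol order_trans[OF interior_subset sub]])
  moreover have "continuous_on (closure S) f"
    unfolding cl by (rule holomorphic_on_imp_continuous_on[OF holomorphic_on_subset[OF hol sub]])
  moreover have "bounded S"
    by (rule bounded_subset[OF bounded_cball[of 0 b]]) (auto simp: S_def)
  moreover have "norm (f w) \<le> B" if "w \<in> frontier S" for w
    using subsetD[OF frontier_annulus_subset that[unfolded S_def]] by (intro B) simp
  moreover have "z \<in> S"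
    using z by (simp add: S_def)
  ultimately show ?thesis
    by (rule maximum_modulus_frontier)
qed

lemma nonpos_if_le_inverse_nat:
  fixes x C :: real
  assumes "\<And>N::nat. N > 0 \<Longrightarrow> x \<le> C / real N"
  shows "x \<le> 0"
proof (rule tendsto_lowerbound)
  show "(\<lambda>N. C / real N) \<longlonglongrightarrow> 0"
    by real_asymp
  show "\<forall>\<^sub>F N in sequentially. x \<le> C / real N"
    using assms by (intro eventually_sequentiallyI[of 1]) auto
qed simp

text \<open>The natural comparison function is \<open>h\<close> times the power of z with real
  exponent L / (- ln \<rho>1), which is not single-valued. The functions
  \<open>h z ^ N * z ^ k\<close> with k close to N times this exponent replace it, and N tends to
  infinity. At the outer circle only the upper limit of the modulus is controlled, since
  \<open>h\<close> need not have boundary values.\<close>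

lemma three_circles_unit_boundary:
  fixes h :: "complex \<Rightarrow> complex"
  assumes hol: "h holomorphic_on {z. \<rho>0 < norm z \<and> norm z < 1}"
    and \<rho>: "0 < \<rho>0" "\<rho>0 < \<rho>1" "\<rho>1 \<le> \<rho>2" "\<rho>2 < 1"
    and nz: "\<And>z. \<rho>0 < norm z \<Longrightarrow> norm z < 1 \<Longrightarrow> h z \<noteq> 0"
    and inner: "\<And>z. norm z = \<rho>1 \<Longrightarrow> ln (norm (h z)) \<le> L" and "L \<ge> 0"
    and bdry: "\<And>e. e > 0 \<Longrightarrow> \<exists>\<rho><1. \<forall>z. \<rho> < norm z \<and> norm z < 1 \<longrightarrow> norm (h z) \<le> 1 + e"
    and z: "norm z = \<rho>2"
  shows "ln (norm (h z)) \<le> ln \<rho>2 / ln \<rho>1 * L"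
proof -
  have ln1: "ln \<rho>1 < 0" and ln2: "ln \<rho>2 < 0"
    using \<rho> by auto
  \<comment> \<open>The exponent with L + a * ln \<rho>1 = 0: it turns the bound on the inner circle
    into 1.\<close>
  define a where "a = L / (- ln \<rho>1)"
  have "a \<ge> 0"
    using ln1 \<open>L \<ge> 0\<close> by (simp add: a_def divide_nonneg_neg)
  have hz: "h z \<noteq> 0"
    using nz z \<rho> by auto
  have "ln (norm (h z)) - a * (- ln \<rho>2) \<le> (1 - ln \<rho>2) / real N" if "N > 0" for N
  proof -
    define e where "e = 1 / real N"
    \<comment> \<open>Rounding up preserves the bound on the inner circle and costs at most one
      factor \<rho>2 at \<open>z\<close>, which disappears after taking N-th roots.\<close>
    define k where "k = nat \<lceil>N * a\<rceil>"
    have "e > 0"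
      using \<open>N > 0\<close> by (simp add: e_def)
    have k: "N * a \<le> k" "k \<le> N * a + 1"
      using \<open>a \<ge> 0\<close> by (auto simp: k_def)
    obtain \<rho> where "\<rho> < 1" and \<rho>b: "\<And>z. \<rho> < norm z \<Longrightarrow> norm z < 1 \<Longrightarrow> norm (h z) \<le> 1 + e"
      using bdry \<open>e > 0\<close> by meson
    \<comment> \<open>The outer circle lies beyond \<open>z\<close> and so near the unit circle that
      \<open>h\<close> is bounded by 1 + e on it.\<close>
    obtain \<rho>' where \<rho>': "max \<rho> \<rho>2 < \<rho>'" "\<rho>' < 1"
      using dense[of "max \<rho> \<rho>2" 1] \<open>\<rho> < 1\<close> \<rho> by auto
    have "norm (h z ^ N * z ^ k) \<le> (1 + e) ^ N"
    proof (rule maximum_modulus_annulus[where f = "\<lambda>z. h z ^ N * z ^ k"])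
      show "(\<lambda>z. h z ^ N * z ^ k) holomorphic_on {z. \<rho>0 < norm z \<and> norm z < 1}"
        by (intro holomorphic_intros hol)
      fix w :: complex
      assume "norm w = \<rho>1 \<or> norm w = \<rho>'"
      then show "norm (h w ^ N * w ^ k) \<le> (1 + e) ^ N"
      proof
        assume w: "norm w = \<rho>1"
        then have "h w \<noteq> 0" "w \<noteq> 0"
          using nz \<rho> by auto
        then have "ln (norm (h w ^ N * w ^ k)) = N * ln (norm (h w)) + k * ln \<rho>1"
          using w \<rho> by (simp add: norm_mult norm_power ln_mult ln_realpow)
        also have "\<dots> \<le> N * L + (N * a) * ln \<rho>1"
          using inner[OF w] k ln1 by (intro add_mono mult_left_mono mult_right_mono_neg) auto
        also have "\<dots> = 0"
          using ln1 by (simp add: a_def)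
        finally have "norm (h w ^ N * w ^ k) \<le> 1"
          using \<open>h w \<noteq> 0\<close> \<open>w \<noteq> 0\<close> by (subst (asm) ln_le_zero_iff) auto
        also have "\<dots> \<le> (1 + e) ^ N"
          using \<open>e > 0\<close> by (intro one_le_power) auto
        finally show ?thesis .
      next
        assume w: "norm w = \<rho>'"
        have "norm (h w) ^ N * norm w ^ k \<le> (1 + e) ^ N * 1"
          using \<rho>b[of w] w \<rho>' \<rho> \<open>e > 0\<close> by (intro mult_mono power_mono power_le_one) auto
        then show ?thesis
          by (simp add: norm_mult norm_power)
      qed
    qed (use \<rho> \<rho>' z in auto)
    then have "ln (norm (h z ^ N * z ^ k)) \<le> ln ((1 + e) ^ N)"
      using hz z \<rho> \<open>e > 0\<close> by (subst ln_le_cancel_iff) auto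
    moreover have "ln (norm (h z ^ N * z ^ k)) = N * ln (norm (h z)) + k * ln \<rho>2"
      using z \<rho> hz by (subst z[symmetric]) (simp add: norm_mult norm_power ln_mult ln_realpow)
    moreover have "ln ((1 + e) ^ N) \<le> N * e"
      using \<open>e > 0\<close> ln_add_one_self_le_self[of e] by (simp add: ln_realpow mult_left_mono)
    moreover have "(N * a + 1) * ln \<rho>2 \<le> k * ln \<rho>2"
      using k ln2 by (intro mult_right_mono_neg) auto
    ultimately have "N * ln (norm (h z)) \<le> N * e - (N * a + 1) * ln \<rho>2"
      by linarith
    then show ?thesis
      using \<open>N > 0\<close> by (simp add: e_def field_simps)
  qed
  then have "ln (norm (h z)) - a * (- ln \<rho>2) \<le> 0"
    by (rule nonpos_if_le_inverse_nat)
  then show ?thesis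
    by (simp add: a_def mult.commute)
qed

text \<open>A point with real part below A is closer to 0 than to 2 * A, the mirror image of 0, so l
  / (2 * A - l) takes values in the unit disc. Schwarz's lemma for this function, rescaled to the
  unit disc, gives the bound.\<close>

lemma Borel_Caratheodory:
  fixes l :: "complex \<Rightarrow> complex" and R A :: real
  assumes hol: "l holomorphic_on ball 0 R" and "R > 0" "A > 0" and l0: "l 0 = 0"
    and Re: "\<And>z. norm z < R \<Longrightarrow> Re (l z) < A" and z: "norm z < R"
  shows "norm (l z) \<le> 2 * A * norm z / (R - norm z)"
proof -
  have lt: "norm (l w) < norm (2 * of_real A - l w)" if "norm w < R" for w
  proof (rule power2_less_imp_less)
    have "(norm (2 * of_real A - l w))\<^sup>2 - (norm (l w))\<^sup>2 = 4 * A * (A - Re (l w))"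
      unfolding cmod_power2 by (simp add: power2_eq_square algebra_simps)
    also have "\<dots> > 0"
      using Re[OF that] \<open>A > 0\<close> by simp
    finally show "(norm (l w))\<^sup>2 < (norm (2 * of_real A - l w))\<^sup>2"
      by simp
  qed simp
  define g where "g = (\<lambda>w. l (of_real R * w) / (2 * of_real A - l (of_real R * w)))"
  have sm: "norm (of_real R * w :: complex) < R" if "norm w < 1" for w
    using that \<open>R > 0\<close> by (simp add: norm_mult)
  have g1: "norm (g w) < 1" and ne: "2 * of_real A - l (of_real R * w) \<noteq> 0" if "norm w < 1" for w
  proof -
    have *: "norm (l (of_real R * w)) < norm (2 * of_real A - l (of_real R * w))"
      using lt sm that by blast
    show "2 * of_real A - l (of_real R * w) \<noteq> 0"
      using le_less_trans[OF norm_ge_zero *] by (simp only: zero_less_norm_iff not_False_eq_True)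
    then show "norm (g w) < 1"
      unfolding g_def norm_divide using * le_less_trans[OF norm_ge_zero *]
      by (subst pos_divide_less_eq) simp_all
  qed
  have zR: "norm (z / of_real R) < 1"
    using z \<open>R > 0\<close> by (simp add: norm_divide)
  have Rz: "of_real R * (z / of_real R) = z"
    using \<open>R > 0\<close> by simp
  have "norm (g (z / of_real R)) \<le> norm (z / of_real R)"
  proof (rule Schwarz_Lemma(1)[OF _ _ g1 zR])
    have "(\<lambda>w. l (of_real R * w)) holomorphic_on ball 0 1"
      by (rule holomorphic_on_compose_gen[OF _ hol, unfolded o_def])
         (use sm in \<open>auto intro!: holomorphic_intros\<close>)
    then show "g holomorphic_on ball 0 1"
      unfolding g_def using ne by (intro holomorphic_intros) auto
  qed (simp_all add: g_def l0)
  then have "norm (l z) / norm (2 * of_real A - l z) \<le> norm z / R"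
    unfolding g_def norm_divide Rz using \<open>R > 0\<close> by simp
  moreover have "norm (2 * of_real A - l z) > 0"
    by (rule le_less_trans[OF norm_ge_zero lt[OF z]])
  ultimately have "norm (l z) \<le> norm z / R * norm (2 * of_real A - l z)"
    by (simp only: pos_divide_le_eq)
  then have "norm (l z) * R \<le> norm z * norm (2 * of_real A - l z)"
    using \<open>R > 0\<close> by (simp add: pos_le_divide_eq)
  also have "\<dots> \<le> norm z * (2 * A + norm (l z))"
    using norm_triangle_ineq4[of "2 * of_real A" "l z"] \<open>A > 0\<close>
    by (intro mult_left_mono) (auto simp: norm_mult)
  finally have "norm (l z) * (R - norm z) \<le> 2 * A * norm z"
    by (simp add: algebra_simps)
  then show ?thesis
    using z by (simp add: pos_le_divide_eq)
qed

lemma norm_exp_minus_1_le: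
  fixes w :: complex
  shows "norm (exp w - 1) \<le> norm w * exp (norm w)"
proof -
  have "norm (exp w - exp 0) \<le> exp (norm w) * norm (w - 0)"
  proof (rule field_differentiable_bound[where S = "closed_segment 0 w" and f' = exp])
    fix u assume "u \<in> closed_segment 0 w"
    then have "norm u \<le> norm w"
      using segment_bound(1) by fastforce
    then show "norm (exp u) \<le> exp (norm w)"
      using complex_Re_le_cmod[of u] by (simp add: norm_exp_eq_Re)
  qed (auto intro: DERIV_subset DERIV_exp)
  then show ?thesis by (simp add: mult.commute)
qed

text \<open>Cauchy's inequality at a point of the smaller disc holds for every radius below R -
  \<rho>; the limit gives the constant, as \<open>f\<close> need not extend to the boundary of the
  larger disc.\<close>

lemma norm_diff_le_if_bounded:
  fixes f :: "complex \<Rightarrow> complex"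
  assumes hol: "f holomorphic_on ball a R" and B: "\<And>z. z \<in> ball a R \<Longrightarrow> norm (f z) \<le> B"
    and "\<rho> < R" "x \<in> cball a \<rho>" "y \<in> cball a \<rho>"
  shows "norm (f x - f y) \<le> B / (R - \<rho>) * norm (x - y)"
proof (rule field_differentiable_bound)
  fix z assume z: "z \<in> cball a \<rho>"
  then have zR: "z \<in> ball a R"
    using \<open>\<rho> < R\<close> by auto
  then show "(f has_field_derivative deriv f z) (at z within cball a \<rho>)"
    by (rule has_field_derivative_at_within[OF holomorphic_derivI[OF hol open_ball]])
  have "norm (deriv f z) \<le> B / r" if r: "0 < r" "r < R - \<rho>" for r
  proof -
    have sub: "cball z r \<subseteq> ball a R"
    proof
      fix u assume "u \<in> cball z r"
      then show "u \<in> ball a R"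
        using z r dist_triangle[of a u z] by auto
    qed
    have "norm ((deriv ^^ 1) f z) \<le> fact 1 * B / r ^ 1"
    proof (rule Cauchy_inequality)
      show "f holomorphic_on ball z r"
        by (rule holomorphic_on_subset[OF hol order_trans[OF ball_subset_cball sub]])
      show "continuous_on (cball z r) f"
        by (rule holomorphic_on_imp_continuous_on[OF holomorphic_on_subset[OF hol sub]])
      show "norm (f x) \<le> B" if "norm (z - x) = r" for x
        using that sub B[of x] by (auto simp: dist_norm subset_iff)
    qed (use r in auto)
    then show ?thesis by simp
  qed
  moreover have "((\<lambda>r. B / r) \<longlongrightarrow> B / (R - \<rho>)) (at_left (R - \<rho>))"
    using \<open>\<rho> < R\<close> by (intro tendsto_intros) auto
  moreover have "\<forall>\<^sub>F r in at_left (R - \<rho>). norm (deriv f z) \<le> B / r"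
    using calculation(1) \<open>\<rho> < R\<close>
    by (auto simp: eventually_at_left_field intro!: exI[of _ 0])
  ultimately show "norm (deriv f z) \<le> B / (R - \<rho>)"
    by (intro tendsto_lowerbound) auto
qed (use assms in auto)

section \<open>Comparison of a conformal map with approximate parametrizations\<close>

lemma abs_ln_diff_le:
  fixes a b c :: real
  assumes "c > 0" "a \<ge> c" "b \<ge> c"
  shows "\<bar>ln a - ln b\<bar> \<le> \<bar>a - b\<bar> / c"
proof -
  have *: "ln x - ln y \<le> \<bar>x - y\<bar> / c" if "x \<ge> c" "y \<ge> c" for x y :: real
  proof -
    have "ln x - ln y \<le> (x - y) / y"
      using that assms by (intro ln_diff_le) auto
    also have "\<dots> \<le> \<bar>x - y\<bar> / y"
      using that assms by (intro divide_right_mono) auto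
    also have "\<dots> \<le> \<bar>x - y\<bar> / c"
      using that assms by (intro divide_left_mono) auto
    finally show ?thesis .
  qed
  show ?thesis
    using *[of a b] *[of b a] assms by (auto simp: abs_if split: if_splits)
qed

text \<open>In the following locale \<open>F\<close> approximates \<open>\<Phi>\<close>, up to reparametrization, near the unit circle and \<open>P\<close>
  approximates it away from the circle. The factors of the constant are the Lipschitz constant of
  \<open>ln (norm (\<Phi>\<^sup>-\<^sup>1 w))\<close>, the sum of the geometric series of the contraction between the circles of radii
  \<open>\<rho>1\<close> and \<open>\<rho>2\<close>, and the loss in the Borel--Caratheodory inequality.\<close>

definition comparison_const :: "real \<Rightarrow> real \<Rightarrow> real \<Rightarrow> real \<Rightarrow> real \<Rightarrow> real \<Rightarrow> real" where
  "comparison_const S s \<eta> \<rho>0 \<rho>1 \<rho>2 =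
     4 * S / (\<eta> * s) * (1 + 2 / (1 - ln \<rho>2 / ln \<rho>1)) * (1 + 6 * \<rho>0 / (\<rho>2 - \<rho>0))"

locale disc_comparison =
  fixes U :: "complex set" and \<Phi> F P :: "complex \<Rightarrow> complex"
    and \<rho>0 \<rho>1 \<rho>2 \<rho>3 S s \<eta> \<delta> :: real
  assumes \<rho>: "0 < \<rho>0" "\<rho>0 < \<rho>1" "\<rho>1 < \<rho>2" "\<rho>2 < \<rho>3" "\<rho>3 < 1"
    and pos: "S > 0" "s > 0" "\<eta> > 0" "\<delta> > 0"
    and \<delta>: "\<delta> \<le> \<eta> / 2" "\<delta> \<le> s / 2"
    and \<Phi>_hol: "\<Phi> holomorphic_on ball 0 1" and \<Phi>_bij: "bij_betw \<Phi> (ball 0 1) U"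
    and \<Phi>_0: "\<Phi> 0 = 0" and \<Phi>_deriv: "deriv \<Phi> 0 \<in> \<real>" "0 < Re (deriv \<Phi> 0)"
    and U_bound: "\<And>w. w \<in> U \<Longrightarrow> norm w < S"
    and P_hol: "P holomorphic_on ball 0 \<rho>3" and P_0: "P 0 = 0"
    and P_deriv: "deriv P 0 \<in> \<real>" "0 < Re (deriv P 0)"
    and P_ball: "\<And>z. norm z < \<rho>3 \<Longrightarrow> ball (P z) \<eta> \<subseteq> U"
    and P_nz: "\<And>z. 0 < norm z \<Longrightarrow> norm z < \<rho>3 \<Longrightarrow> P z \<noteq> 0"
    and P_lower: "\<And>z. \<rho>1 \<le> norm z \<Longrightarrow> norm z \<le> \<rho>2 \<Longrightarrow> s \<le> norm (P z)"
    and F_hol: "F holomorphic_on {z. \<rho>0 < norm z \<and> norm z < 1}"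
    and F_U: "\<And>z. \<rho>0 < norm z \<Longrightarrow> norm z < 1 \<Longrightarrow> F z \<in> U - {0}"
    and F_proper: "\<And>Q. compact Q \<Longrightarrow> Q \<subseteq> U \<Longrightarrow> \<exists>\<rho><1. \<forall>z. \<rho> < norm z \<and> norm z < 1 \<longrightarrow> F z \<notin> Q"
    and F_P: "\<And>z. norm z = \<rho>1 \<or> norm z = \<rho>2 \<Longrightarrow> norm (F z - P z) \<le> \<delta>"
begin

definition g :: "complex \<Rightarrow> complex" where "g = inv_into (ball 0 1) \<Phi>"

lemma g_\<Phi>: "norm z < 1 \<Longrightarrow> g (\<Phi> z) = z"
  using \<Phi>_bij by (simp add: g_def bij_betw_def inv_into_f_f)

lemma \<Phi>_g: "w \<in> U \<Longrightarrow> \<Phi> (g w) = w"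
  using \<Phi>_bij by (metis bij_betw_imp_surj_on f_inv_into_f g_def)

lemma norm_g_less_1: "w \<in> U \<Longrightarrow> norm (g w) < 1"
  using \<Phi>_bij by (metis bij_betw_imp_surj_on g_def inv_into_into mem_ball_0)

lemma \<Phi>_in_U: "norm z < 1 \<Longrightarrow> \<Phi> z \<in> U"
  using \<Phi>_bij by (metis bij_betwE mem_ball_0)

lemma open_U: "open U"
  using open_mapping_thm3[OF \<Phi>_hol open_ball] \<Phi>_bij by (auto simp: bij_betw_def)

lemma g_holomorphic: "g holomorphic_on U" and g_deriv: "deriv \<Phi> 0 * deriv g 0 = 1"
proof -
  have inj: "inj_on \<Phi> (ball 0 1)" and img: "\<Phi> ` ball 0 1 = U"
    using \<Phi>_bij by (auto simp: bij_betw_def)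
  obtain g' where g': "g' holomorphic_on (\<Phi> ` ball 0 1)"
    "\<And>z. z \<in> ball 0 1 \<Longrightarrow> deriv \<Phi> z * deriv g' (\<Phi> z) = 1"
    "\<And>z. z \<in> ball 0 1 \<Longrightarrow> g' (\<Phi> z) = z"
    using holomorphic_has_inverse[OF \<Phi>_hol open_ball inj] by blast
  have eq: "g w = g' w" if "w \<in> U" for w
    using that img g'(3) g_\<Phi> by (metis imageE mem_ball_0)
  show "g holomorphic_on U"
    using g'(1) img eq by (metis holomorphic_cong)
  have "deriv g 0 = deriv g' 0"
  proof (rule deriv_cong_ev)
    have "0 \<in> U"
      using \<Phi>_in_U[of 0] \<Phi>_0 by simp
    then show "\<forall>\<^sub>F w in nhds 0. g w = g' w"
      using open_U eq by (auto simp: eventually_nhds)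
  qed simp
  then show "deriv \<Phi> 0 * deriv g 0 = 1"
    using g'(2)[of 0] \<Phi>_0 by simp
qed

text \<open>Schwarz's lemma for \<Phi> / S. It serves as a lower bound for the modulus of
  \<open>g\<close> away from 0, where logarithms are taken.\<close>

lemma norm_le_norm_g:
  assumes "w \<in> U"
  shows "norm w \<le> S * norm (g w)"
proof -
  have "norm (\<Phi> (g w) / of_real S) \<le> norm (g w)"
  proof (rule Schwarz_Lemma(1))
    show "(\<lambda>z. \<Phi> z / of_real S) holomorphic_on ball 0 1"
      using pos by (intro holomorphic_intros \<Phi>_hol) auto
    show "norm (\<Phi> z / of_real S) < 1" if "norm z < 1" for z
      using U_bound[OF \<Phi>_in_U[OF that]] pos by (simp add: norm_divide)
  qed (use \<Phi>_0 norm_g_less_1[OF assms] in auto)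
  then show ?thesis
    using pos \<Phi>_g[OF assms] by (simp add: norm_divide divide_le_eq mult.commute)
qed

lemma g_nonzero: "w \<in> U \<Longrightarrow> w \<noteq> 0 \<Longrightarrow> g w \<noteq> 0"
  using \<Phi>_g \<Phi>_0 by metis

text \<open>On the disc of radius \<eta> about \<open>P z\<close> the map \<open>g\<close> is
  bounded by 1; the factor is its Lipschitz constant on the concentric disc of half the
  radius.\<close>

lemma g_lipschitz:
  assumes "norm z < \<rho>3" and "norm (w - P z) \<le> \<eta> / 2"
  shows "norm (g w - g (P z)) \<le> 2 / \<eta> * norm (w - P z)"
proof -
  have "norm (g w - g (P z)) \<le> 1 / (\<eta> - \<eta> / 2) * norm (w - P z)"
  proof (rule norm_diff_le_if_bounded)
    show "g holomorphic_on ball (P z) \<eta>"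
      by (rule holomorphic_on_subset[OF g_holomorphic P_ball[OF assms(1)]])
    show "norm (g u) \<le> 1" if "u \<in> ball (P z) \<eta>" for u
      using norm_g_less_1[of u] P_ball[OF assms(1)] that by (auto simp: subset_iff)
  qed (use pos assms in \<open>auto simp: dist_norm norm_minus_commute\<close>)
  then show ?thesis
    by simp
qed

lemma P_in_U: "norm z < \<rho>3 \<Longrightarrow> P z \<in> U"
  using P_ball[of z] pos by auto

text \<open>Since \<delta> is at most s / 2, both points have modulus at least s / 2, so their
  images under \<open>g\<close> have modulus at least s / (2 * S), where the logarithm has Lipschitz
  constant 2 * S / s. The factor 2 / \<eta> comes from \<open>g_lipschitz\<close>.\<close>

lemma ln_norm_g_diff:
  assumes z: "norm z = \<rho>1 \<or> norm z = \<rho>2"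
  shows "\<bar>ln (norm (g (F z))) - ln (norm (g (P z)))\<bar> \<le> 4 * S / (\<eta> * s) * \<delta>"
proof -
  have z3: "norm z < \<rho>3" and F_in: "F z \<in> U" and P_in: "P z \<in> U"
    using z \<rho> F_U[of z] P_in_U[of z] by auto
  have sP: "s \<le> norm (P z)"
    using P_lower[of z] z \<rho> by auto
  have "norm (P z) \<le> norm (F z) + norm (F z - P z)"
    by (metis norm_minus_commute norm_triangle_sub)
  then have sF: "s / 2 \<le> norm (F z)"
    using F_P[OF z] \<delta> sP by linarith
  have lower: "s / (2 * S) \<le> norm (g w)" if "w \<in> U" "s / 2 \<le> norm w" for w
  proof -
    have "s / 2 \<le> S * norm (g w)"
      using norm_le_norm_g[OF that(1)] that(2) by linarith
    then show ?thesis
      using pos by (simp add: field_simps)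
  qed
  have "\<bar>ln (norm (g (F z))) - ln (norm (g (P z)))\<bar>
      \<le> \<bar>norm (g (F z)) - norm (g (P z))\<bar> / (s / (2 * S))"
    using lower[OF F_in sF] lower[OF P_in] sP pos by (intro abs_ln_diff_le) auto
  also have "\<dots> \<le> (2 / \<eta> * \<delta>) / (s / (2 * S))"
  proof (intro divide_right_mono)
    have "\<bar>norm (g (F z)) - norm (g (P z))\<bar> \<le> norm (g (F z) - g (P z))"
      by (rule norm_triangle_ineq3)
    also have "\<dots> \<le> 2 / \<eta> * norm (F z - P z)"
      using F_P[OF z] \<delta> by (intro g_lipschitz z3) auto
    also have "\<dots> \<le> 2 / \<eta> * \<delta>"
      using F_P[OF z] pos by (intro mult_left_mono) auto
    finally show "\<bar>norm (g (F z)) - norm (g (P z))\<bar> \<le> 2 / \<eta> * \<delta>" .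
  qed (use pos in auto)
  also have "\<dots> = 4 * S / (\<eta> * s) * \<delta>"
    by simp
  finally show ?thesis .
qed

text \<open>Both g (F z) and z have modulus tending to 1 at the unit circle, so the logarithmic
  modulus of the quotient tends to 0 there. Dividing by z also matches \<open>h\<close> with the
  quotient of g (P z) by z, which extends holomorphically over 0.\<close>

definition h :: "complex \<Rightarrow> complex" where "h z = g (F z) / z"

lemma h_holomorphic: "h holomorphic_on {z. \<rho>0 < norm z \<and> norm z < 1}"
proof -
  have "(\<lambda>z. g (F z)) holomorphic_on {z. \<rho>0 < norm z \<and> norm z < 1}"
    by (rule holomorphic_on_compose_gen[OF F_hol g_holomorphic, unfolded o_def]) (use F_U in auto)
  then show ?thesis
    unfolding h_def[abs_def] using \<rho> by (intro holomorphic_intros) auto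
qed

lemma h_nonzero: "\<rho>0 < norm z \<Longrightarrow> norm z < 1 \<Longrightarrow> h z \<noteq> 0"
  using F_U[of z] g_nonzero[of "F z"] \<rho> by (auto simp: h_def)

text \<open>Properness of \<open>F\<close> replaces boundary values: near the circle F z leaves the
  compact image of \<open>cball 0 q\<close> under \<Phi>, so g (F z) has modulus above q. The choice
  q = 1 / (1 + e) serves both bounds.\<close>

lemma h_boundary:
  assumes "e > 0"
  shows "\<exists>\<rho><1. \<forall>z. \<rho> < norm z \<and> norm z < 1 \<longrightarrow> norm (h z) \<le> 1 + e \<and> norm (inverse (h z)) \<le> 1 + e"
proof -
  define q where "q = 1 / (1 + e)"
  have q: "0 < q" "q < 1"
    using assms by (auto simp: q_def)
  have "cball 0 q \<subseteq> ball (0::complex) 1"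
    using q by auto
  then have "compact (\<Phi> ` cball 0 q)"
    by (intro compact_continuous_image compact_cball holomorphic_on_imp_continuous_on)
       (rule holomorphic_on_subset[OF \<Phi>_hol])
  moreover have "\<Phi> ` cball 0 q \<subseteq> U"
    using \<Phi>_in_U q by auto
  ultimately obtain \<rho> where \<rho>': "\<rho> < 1" "\<And>z. \<rho> < norm z \<Longrightarrow> norm z < 1 \<Longrightarrow> F z \<notin> \<Phi> ` cball 0 q"
    using F_proper by meson
  show ?thesis
  proof (intro exI[of _ "max (max \<rho> \<rho>0) q"] conjI allI impI)
    show "max (max \<rho> \<rho>0) q < 1"
      using \<rho> \<rho>' q by auto
    fix z :: complex
    assume "max (max \<rho> \<rho>0) q < norm z \<and> norm z < 1"
    then have z: "\<rho> < norm z" "\<rho>0 < norm z" "q < norm z" "norm z < 1"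
      by auto
    have F_in: "F z \<in> U"
      using F_U[of z] z by auto
    have "norm (h z) \<le> 1 / norm z"
      using norm_g_less_1[OF F_in] by (auto simp: h_def norm_divide intro!: divide_right_mono)
    also have "\<dots> \<le> 1 / q"
      using z q by (intro divide_left_mono mult_pos_pos) auto
    finally show "norm (h z) \<le> 1 + e"
      by (simp add: q_def)
    have "q < norm (g (F z))"
    proof (rule ccontr)
      assume "\<not> q < norm (g (F z))"
      then have "\<Phi> (g (F z)) \<in> \<Phi> ` cball 0 q"
        by (intro imageI) auto
      then show False
        using \<rho>'(2)[OF z(1) z(4)] \<Phi>_g[OF F_in] by simp
    qed
    then have "norm (inverse (h z)) \<le> 1 / q"
      unfolding h_def using z q
      by (simp only: inverse_divide norm_divide) (intro frac_le, auto)
    then show "norm (inverse (h z)) \<le> 1 + e"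
      by (simp add: q_def)
  qed
qed


text \<open>The estimate refers to itself: with m the maximum of the absolute value of
  \<open>ln (norm (h w))\<close> on the circle of radius \<rho>1, it returns m \<le> \<theta> * m +
  2 * (K * \<delta>) with \<theta> < 1, and m is absorbed on the left. Zero-freeness of
  \<open>k\<close>, at 0 by hypothesis, lets the maximum principle apply to 1 / k as well, so the
  bound is two-sided.\<close>

lemma ln_norm_quotient_bound:
  assumes k_hol: "k holomorphic_on ball 0 \<rho>3"
    and k_eq: "\<And>z. norm z < \<rho>3 \<Longrightarrow> g (P z) = z * k z" and k_0: "k 0 \<noteq> 0"
    and z: "norm z \<le> \<rho>2"
  shows "k z \<noteq> 0"
    and "\<bar>ln (norm (k z))\<bar> \<le> 4 * S / (\<eta> * s) * (1 + 2 / (1 - ln \<rho>2 / ln \<rho>1)) * \<delta>"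
proof -
  define K where "K = 4 * S / (\<eta> * s)"
  define \<theta> where "\<theta> = ln \<rho>2 / ln \<rho>1"
  have ln\<rho>: "ln \<rho>1 < 0" "ln \<rho>2 < 0" "ln \<rho>1 < ln \<rho>2"
    using \<rho> by auto
  have \<theta>: "0 \<le> \<theta>" "\<theta> < 1"
    using ln\<rho> by (auto simp: \<theta>_def divide_nonpos_nonpos divide_less_eq)
  have k_nz: "k w \<noteq> 0" if "norm w < \<rho>3" for w
  proof (cases "w = 0")
    case False
    then have "g (P w) \<noteq> 0"
      using that P_nz[of w] P_in_U[OF that] g_nonzero by auto
    then show ?thesis
      using k_eq[OF that] by auto
  qed (use k_0 in auto)
  have hk: "\<bar>ln (norm (h w)) - ln (norm (k w))\<bar> \<le> K * \<delta>" if w: "norm w = \<rho>1 \<or> norm w = \<rho>2" for w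
  proof -
    have w': "norm w < \<rho>3" "w \<noteq> 0" "F w \<in> U - {0}"
      using w \<rho> F_U[of w] by auto
    have "ln (norm (h w)) = ln (norm (g (F w))) - ln (norm w)"
      using w' g_nonzero[of "F w"] by (simp add: h_def norm_divide ln_div)
    moreover have "ln (norm (g (P w))) = ln (norm w) + ln (norm (k w))"
      using w' k_nz by (simp add: k_eq norm_mult ln_mult)
    ultimately show ?thesis
      using ln_norm_g_diff[OF w] by (simp add: K_def)
  qed
  have cont: "continuous_on (sphere 0 \<rho>1) (\<lambda>w. \<bar>ln (norm (h w))\<bar>)"
  proof -
    have "continuous_on (sphere 0 \<rho>1) h"
      using \<rho> by (intro holomorphic_on_imp_continuous_on holomorphic_on_subset[OF h_holomorphic]) auto
    then show ?thesis
      using h_nonzero \<rho> by (intro continuous_intros) auto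
  qed
  have ne: "sphere (0::complex) \<rho>1 \<noteq> {}"
    using \<rho> by simp
  \<comment> \<open>\<open>h\<close> has no zeros on this compact circle, so the maximum exists
    before any estimate of it is known.\<close>
  obtain z1 where z1: "norm z1 = \<rho>1"
    "\<And>w. norm w = \<rho>1 \<Longrightarrow> \<bar>ln (norm (h w))\<bar> \<le> \<bar>ln (norm (h z1))\<bar>"
    using continuous_attains_sup[OF compact_sphere ne cont] by auto
  define m where "m = \<bar>ln (norm (h z1))\<bar>"
  have h2: "\<bar>ln (norm (h w))\<bar> \<le> \<theta> * m" if w: "norm w = \<rho>2" for w
  proof -
    have "ln (norm (h w)) \<le> ln \<rho>2 / ln \<rho>1 * m"
    proof (rule three_circles_unit_boundary[where h = h])
      show "\<exists>\<rho><1. \<forall>z. \<rho> < norm z \<and> norm z < 1 \<longrightarrow> norm (h z) \<le> 1 + e" if "e > 0" for e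
        using h_boundary[OF that] by blast
      show "ln (norm (h u)) \<le> m" if "norm u = \<rho>1" for u
        using z1(2)[OF that] by (auto simp: m_def)
    qed (use \<rho> w h_holomorphic h_nonzero in \<open>auto simp: m_def\<close>)
    moreover have "ln (norm (inverse (h w))) \<le> ln \<rho>2 / ln \<rho>1 * m"
    proof (rule three_circles_unit_boundary[where h = "\<lambda>z. inverse (h z)"])
      show "(\<lambda>z. inverse (h z)) holomorphic_on {z. \<rho>0 < norm z \<and> norm z < 1}"
        using h_nonzero by (intro holomorphic_intros h_holomorphic) auto
      show "\<exists>\<rho><1. \<forall>z. \<rho> < norm z \<and> norm z < 1 \<longrightarrow> norm (inverse (h z)) \<le> 1 + e" if "e > 0" for e
        using h_boundary[OF that] by blast
      show "ln (norm (inverse (h u))) \<le> m" if "norm u = \<rho>1" for u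
        using z1(2)[OF that] h_nonzero[of u] that \<rho> by (auto simp: m_def norm_inverse ln_inverse)
    qed (use \<rho> w h_nonzero in \<open>auto simp: m_def\<close>)
    moreover have "h w \<noteq> 0"
      using h_nonzero[of w] w \<rho> by auto
    ultimately show ?thesis
      by (simp add: \<theta>_def norm_inverse ln_inverse abs_le_iff)
  qed
  have k_bound: "\<bar>ln (norm (k w))\<bar> \<le> \<theta> * m + K * \<delta>" if w: "norm w \<le> \<rho>2" for w
  proof -
    have int: "interior (cball 0 \<rho>2 :: complex set) \<subseteq> ball 0 \<rho>3"
      "cball 0 \<rho>2 \<subseteq> ball (0::complex) \<rho>3"
      using \<rho> by auto
    have circle: "\<bar>ln (norm (k u))\<bar> \<le> \<theta> * m + K * \<delta>" if "norm u = \<rho>2" for u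
      using h2[OF that] hk[of u] that by linarith
    have mm: "norm (f w) \<le> exp (\<theta> * m + K * \<delta>)"
      if f: "f holomorphic_on ball 0 \<rho>3" "\<And>u. norm u = \<rho>2 \<Longrightarrow> norm (f u) \<le> exp (\<theta> * m + K * \<delta>)" for f
    proof (rule maximum_modulus_frontier[of f "cball 0 \<rho>2"])
      show "f holomorphic_on interior (cball 0 \<rho>2)"
        by (rule holomorphic_on_subset[OF f(1) int(1)])
      show "continuous_on (closure (cball 0 \<rho>2)) f"
        using holomorphic_on_imp_continuous_on[OF holomorphic_on_subset[OF f(1) int(2)]] by simp
    qed (use f(2) w \<rho> in auto)
    have pos_k: "norm (k u) > 0" if "norm u \<le> \<rho>2" for u
      using k_nz[of u] that \<rho> by auto
    have "norm (k w) \<le> exp (\<theta> * m + K * \<delta>)"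
    proof (rule mm[OF k_hol])
      fix u :: complex assume u: "norm u = \<rho>2"
      then have "ln (norm (k u)) \<le> \<theta> * m + K * \<delta>"
        using circle[OF u] by linarith
      then show "norm (k u) \<le> exp (\<theta> * m + K * \<delta>)"
        using pos_k[of u] u by (metis exp_le_cancel_iff exp_ln order_refl)
    qed
    then have "ln (norm (k w)) \<le> \<theta> * m + K * \<delta>"
      using pos_k[OF w] by (metis exp_le_cancel_iff exp_ln)
    have "norm (inverse (k w)) \<le> exp (\<theta> * m + K * \<delta>)"
    proof (rule mm[where f = "\<lambda>z. inverse (k z)"])
      show "(\<lambda>z. inverse (k z)) holomorphic_on ball 0 \<rho>3"
        using k_nz by (intro holomorphic_intros k_hol) auto
      fix u :: complex assume u: "norm u = \<rho>2"
      then have "- ln (norm (k u)) \<le> \<theta> * m + K * \<delta>"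
        using circle[OF u] by linarith
      then have "exp (- ln (norm (k u))) \<le> exp (\<theta> * m + K * \<delta>)"
        by simp
      then show "norm (inverse (k u)) \<le> exp (\<theta> * m + K * \<delta>)"
        using pos_k[of u] u by (simp add: norm_inverse exp_minus)
    qed
    then have "ln (norm (inverse (k w))) \<le> ln (exp (\<theta> * m + K * \<delta>))"
      using pos_k[OF w] by (subst ln_le_cancel_iff) (auto simp: norm_inverse)
    then have "- ln (norm (k w)) \<le> \<theta> * m + K * \<delta>"
      using pos_k[OF w] by (simp add: norm_inverse ln_inverse)
    then show ?thesis
      using \<open>ln (norm (k w)) \<le> \<theta> * m + K * \<delta>\<close> by linarith
  qed
  \<comment> \<open>From \<open>\<rho>1\<close> to \<open>\<rho>2\<close> by the three circles theorem for \<open>h\<close>, and back by the maximum principle for \<open>k\<close>.\<close>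
  have "m \<le> \<theta> * m + 2 * (K * \<delta>)"
    using hk[of z1] k_bound[of z1] z1(1) \<rho> by (simp add: m_def)
  then have "(1 - \<theta>) * m \<le> 2 * (K * \<delta>)"
    by (simp add: algebra_simps)
  then have "m \<le> 2 * (K * \<delta>) / (1 - \<theta>)"
    using \<theta> by (simp add: pos_le_divide_eq mult.commute)
  moreover have "\<theta> * m \<le> m"
    using \<theta> by (simp add: m_def mult_left_le_one_le)
  moreover have "K * (1 + 2 / (1 - \<theta>)) * \<delta> = K * \<delta> + 2 * (K * \<delta>) / (1 - \<theta>)"
    by (simp add: distrib_left distrib_right)
  ultimately have "\<theta> * m + K * \<delta> \<le> K * (1 + 2 / (1 - \<theta>)) * \<delta>"
    by linarith
  then show "\<bar>ln (norm (k z))\<bar> \<le> 4 * S / (\<eta> * s) * (1 + 2 / (1 - ln \<rho>2 / ln \<rho>1)) * \<delta>"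
    using k_bound[OF z] by (simp add: K_def \<theta>_def)
  show "k z \<noteq> 0"
    using k_nz[of z] z \<rho> by auto
qed

text \<open>The logarithm of the quotient k of g (P z) by z has small real part; Borel-Caratheodory
  controls its imaginary part up to a constant, and \<open>k 0\<close> > 0, a quotient of two
  positive derivatives, fixes that constant. So k is near 1 and g (P z) is near z; applying \<Phi>
  gives the claim.\<close>

lemma norm_P_minus_\<Phi>_le:
  defines "G \<equiv> comparison_const S s \<eta> \<rho>0 \<rho>1 \<rho>2"
  assumes small: "3 * G * \<delta> \<le> \<rho>1 - \<rho>0" and z: "norm z \<le> \<rho>0"
  shows "norm (P z - \<Phi> z) \<le> 3 * S * G / (1 - \<rho>1) * \<delta>"
proof -
  define B where "B = 4 * S / (\<eta> * s) * (1 + 2 / (1 - ln \<rho>2 / ln \<rho>1))"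
  have "ln \<rho>1 < 0" "ln \<rho>1 < ln \<rho>2"
    using \<rho> by auto
  then have "ln \<rho>2 / ln \<rho>1 < 1"
    by (simp add: divide_less_eq)
  then have "B > 0"
    unfolding B_def using pos by (intro mult_pos_pos divide_pos_pos add_pos_pos) auto
  have G: "G = B * (1 + 6 * \<rho>0 / (\<rho>2 - \<rho>0))"
    by (simp add: G_def comparison_const_def B_def)
  have "(\<lambda>z. g (P z)) holomorphic_on ball 0 \<rho>3"
    by (rule holomorphic_on_compose_gen[OF P_hol g_holomorphic, unfolded o_def]) (use P_in_U in auto)
  moreover have "g (P 0) = 0"
    using P_0 \<Phi>_0 g_\<Phi>[of 0] by simp
  ultimately obtain k where k: "k holomorphic_on ball 0 \<rho>3"
    "\<And>z. norm z < \<rho>3 \<Longrightarrow> g (P z) = z * k z" "deriv (\<lambda>z. g (P z)) 0 = k 0"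
    by (rule Schwarz3) blast
  have "0 \<in> U"
    using P_in_U[of 0] P_0 \<rho> by auto
  have "deriv (g \<circ> P) 0 = deriv g (P 0) * deriv P 0"
  proof (rule deriv_chain)
    show "P field_differentiable at 0"
      using P_hol \<rho> by (intro holomorphic_on_imp_differentiable_at[OF P_hol]) auto
    show "g field_differentiable at (P 0)"
      using \<open>0 \<in> U\<close> P_0 by (intro holomorphic_on_imp_differentiable_at[OF g_holomorphic open_U]) auto
  qed
  then have "deriv \<Phi> 0 * k 0 = deriv P 0"
    using k(3) P_0 g_deriv by (simp add: o_def)
  moreover have "deriv \<Phi> 0 = of_real (Re (deriv \<Phi> 0))" "deriv P 0 = of_real (Re (deriv P 0))"
    using \<Phi>_deriv P_deriv by auto
  ultimately have k0_eq: "k 0 = of_real (Re (deriv P 0)) / of_real (Re (deriv \<Phi> 0))"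
    using \<Phi>_deriv(2) by (metis nonzero_mult_div_cancel_left of_real_eq_0_iff less_irrefl)
  define k0 where "k0 = Re (deriv P 0) / Re (deriv \<Phi> 0)"
  have k0: "k 0 = of_real k0" "k0 > 0"
    using \<Phi>_deriv P_deriv by (simp_all add: k0_def k0_eq)
  note k_log = ln_norm_quotient_bound[OF k(1,2)]
  have k_nz: "k w \<noteq> 0" and k_bd: "\<bar>ln (norm (k w))\<bar> \<le> B * \<delta>" if "norm w \<le> \<rho>2" for w
    using k_log[OF _ _ that] k0 by (auto simp: B_def)
  have sub: "ball 0 \<rho>2 \<subseteq> ball (0::complex) \<rho>3"
    using \<rho> by auto
  have k_nz': "k w \<noteq> 0" if "w \<in> ball 0 \<rho>2" for w
    using k_nz[of w] that by simp
  obtain l where l: "l holomorphic_on ball 0 \<rho>2" "\<And>w. w \<in> ball 0 \<rho>2 \<Longrightarrow> k w = exp (l w)"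
    by (rule contractible_imp_holomorphic_log[OF holomorphic_on_subset[OF k(1) sub]
          convex_imp_contractible[OF convex_ball] k_nz'], assumption) (rule that)
  have Re_l: "Re (l w) = ln (norm (k w))" if "norm w < \<rho>2" for w
    using l(2)[of w] that by simp
  define l1 where "l1 w = l w - l 0" for w
  have z2: "norm z < \<rho>2"
    using z \<rho> by auto
  \<comment> \<open>The real part of \<open>l1\<close> is at most 2 * (B * \<delta>); the factor 3
    provides the strict inequality.\<close>
  have "norm (l1 z) \<le> 2 * (3 * B * \<delta>) * norm z / (\<rho>2 - norm z)"
  proof (rule Borel_Caratheodory)
    show "l1 holomorphic_on ball 0 \<rho>2"
      unfolding l1_def[abs_def] by (intro holomorphic_intros l)
    show "Re (l1 w) < 3 * B * \<delta>" if "norm w < \<rho>2" for w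
    proof -
      have "\<bar>Re (l w)\<bar> \<le> B * \<delta>" "\<bar>Re (l 0)\<bar> \<le> B * \<delta>"
        using k_bd[of w] k_bd[of 0] Re_l[of w] Re_l[of 0] that \<rho> by auto
      then have "Re (l1 w) \<le> 2 * (B * \<delta>)"
        unfolding l1_def minus_complex.sel by linarith
      also have "\<dots> < 3 * (B * \<delta>)"
        using \<open>B > 0\<close> pos by simp
      finally show ?thesis
        by (simp add: mult.assoc)
    qed
  qed (use \<rho> z2 \<open>B > 0\<close> pos in \<open>auto simp: l1_def\<close>)
  also have "\<dots> \<le> 2 * (3 * B * \<delta>) * \<rho>0 / (\<rho>2 - \<rho>0)"
    using z \<rho> \<open>B > 0\<close> pos by (intro frac_le mult_left_mono) auto
  finally have l1z: "norm (l1 z) \<le> B * (6 * \<rho>0 / (\<rho>2 - \<rho>0)) * \<delta>"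
    by (simp add: mult_ac)
  \<comment> \<open>\<open>l 0\<close> is determined by \<open>k0\<close> only up to a multiple of 2
    * pi * \<i>; the real logarithm replaces it so that the exponent \<open>w\<close> is
    small.\<close>
  define w where "w = of_real (ln k0) + l1 z"
  have "k z = exp w"
  proof -
    have "exp (l 0) = of_real k0"
      using l(2)[of 0] k0 \<rho> by simp
    moreover have "exp (of_real (ln k0)) = (of_real k0 :: complex)"
      using k0 by (simp add: exp_of_real)
    ultimately show ?thesis
      using l(2)[of z] z2 k0 by (simp add: w_def l1_def exp_add exp_diff)
  qed
  have "\<bar>ln k0\<bar> \<le> B * \<delta>"
    using k_bd[of 0] k0 \<rho> by simp
  then have "norm w \<le> B * \<delta> + B * (6 * \<rho>0 / (\<rho>2 - \<rho>0)) * \<delta>"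
    unfolding w_def by (intro norm_triangle_mono[OF _ l1z]) simp
  also have "\<dots> = G * \<delta>"
    unfolding G by (simp only: distrib_left distrib_right mult_1_right)
  finally have w: "norm w \<le> G * \<delta>" .
  have "norm (k z - 1) \<le> norm w * exp (norm w)"
    unfolding \<open>k z = exp w\<close> by (rule norm_exp_minus_1_le)
  also have "\<dots> \<le> (G * \<delta>) * 3"
  proof (intro mult_mono w)
    have "norm w \<le> 1"
      using w small \<rho> by linarith
    then have "exp (norm w) \<le> exp 1"
      by simp
    also have "exp (1::real) \<le> 3"
      by (rule exp_le)
    finally show "exp (norm w) \<le> 3" .
  qed (use order_trans[OF norm_ge_zero w] in auto)
  finally have k1: "norm (k z - 1) \<le> 3 * G * \<delta>"
    by simp
  have "norm (g (P z) - z) = norm z * norm (k z - 1)"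
    unfolding norm_mult[symmetric] using k(2)[of z] z \<rho> by (simp add: right_diff_distrib)
  also have "\<dots> \<le> 1 * (3 * G * \<delta>)"
    using k1 z \<rho> by (intro mult_mono) auto
  finally have gz: "norm (g (P z) - z) \<le> 3 * G * \<delta>"
    by simp
  have PU: "P z \<in> U"
    using P_in_U[of z] z \<rho> by auto
  \<comment> \<open>The smallness hypothesis keeps g (P z) in the disc of radius \<rho>1, where
    \<Phi> has a known Lipschitz constant.\<close>
  have "norm (g (P z)) \<le> norm z + norm (g (P z) - z)"
    by (rule norm_triangle_sub)
  then have gP: "g (P z) \<in> cball 0 \<rho>1" and zc: "z \<in> cball 0 \<rho>1"
    using gz small z \<rho> by auto
  have \<Phi>S: "norm (\<Phi> u) \<le> S" if "u \<in> ball 0 1" for u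
    using U_bound[OF \<Phi>_in_U[of u]] that by auto
  have "\<rho>1 < 1"
    using \<rho> by linarith
  have "norm (\<Phi> (g (P z)) - \<Phi> z) \<le> S / (1 - \<rho>1) * norm (g (P z) - z)"
    by (rule norm_diff_le_if_bounded[OF \<Phi>_hol \<Phi>S \<open>\<rho>1 < 1\<close> gP zc])
  also have "\<dots> \<le> S / (1 - \<rho>1) * (3 * G * \<delta>)"
    using gz \<rho> pos by (intro mult_left_mono) auto
  also have "\<dots> = 3 * S * G / (1 - \<rho>1) * \<delta>"
    by simp
  finally show ?thesis
    unfolding \<Phi>_g[OF PU] .
qed

end

section \<open>The flow of a power field\<close>

lemma Re_one_minus_pos: "norm (w::complex) < 1 \<Longrightarrow> 0 < Re (1 - w)"
  using complex_Re_le_cmod[of w] by simp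

lemma one_minus_nonzero: "norm (w::complex) < 1 \<Longrightarrow> 1 - w \<noteq> 0"
  by auto

text \<open>The solution at time \<open>\<tau>\<close> of \<open>z' = z powi (n + 1)\<close> with \<open>z 0 = p\<close>, written with the principal
  branch of \<open>(1 - n \<tau> p powi n) powr (- 1 / n)\<close>; it is junk beyond \<open>norm (n \<tau> p powi n) < 1\<close>.\<close>

definition power_flow :: "int \<Rightarrow> complex \<Rightarrow> complex \<Rightarrow> complex" where
  "power_flow n \<tau> p =
     (if n = 0 then p * exp \<tau> else p * exp (- Ln (1 - of_int n * \<tau> * p powi n) / of_int n))"

lemma power_flow_0 [simp]: "power_flow n 0 p = p"
  by (simp add: power_flow_def)

lemma power_flow_nonzero: "p \<noteq> 0 \<Longrightarrow> power_flow n \<tau> p \<noteq> 0"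
  by (simp add: power_flow_def)

text \<open>Equivalently, the power with exponent - n moves linearly in time, starting at
  \<open>p powi (- n)\<close> with velocity - n. For nonzero n this determines the flow up to a root
  of unity.\<close>

lemma power_flow_power:
  assumes "p \<noteq> 0" "norm (of_int n * \<tau> * p powi n) < 1"
  shows "power_flow n \<tau> p powi n * (1 - of_int n * \<tau> * p powi n) = p powi n"
proof (cases "n = 0")
  case False
  define d where "d = 1 - of_int n * \<tau> * p powi n"
  have d: "d \<noteq> 0"
    unfolding d_def by (rule one_minus_nonzero[OF assms(2)])
  have "exp (- Ln d / of_int n) powi n = exp (of_int n * (- Ln d / of_int n))"
    by (rule exp_power_int)
  also have "\<dots> = inverse d"
    using False d by (simp add: exp_minus)
  finally have "power_flow n \<tau> p powi n = p powi n * inverse d"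
    using False by (simp add: power_flow_def d_def power_int_mult_distrib)
  then show ?thesis
    using d by (simp add: d_def[symmetric])
qed (simp add: power_flow_def)

text \<open>By \<open>power_flow_power\<close> the image determines \<open>p powi n\<close>. Two
  points could still differ by a root of unity, but the exponential factor of
  \<open>power_flow\<close> depends on the point only through \<open>p powi n\<close>, so it
  cancels.\<close>

lemma inj_on_power_flow:
  assumes "\<And>p. p \<in> K \<Longrightarrow> p \<noteq> 0 \<and> norm (of_int n * \<tau> * p powi n) < 1"
  shows "inj_on (power_flow n \<tau>) K"
proof (rule inj_onI)
  fix p q assume K: "p \<in> K" "q \<in> K" and eq: "power_flow n \<tau> p = power_flow n \<tau> q"
  have p: "p \<noteq> 0" "norm (of_int n * \<tau> * p powi n) < 1" and q: "q \<noteq> 0" "norm (of_int n * \<tau> * q powi n) < 1"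
    using assms K by auto
  define u where "u = power_flow n \<tau> q powi n"
  have "u * (1 - of_int n * \<tau> * p powi n) = p powi n"
    unfolding u_def eq[symmetric] by (rule power_flow_power[OF p])
  moreover have "u * (1 - of_int n * \<tau> * q powi n) = q powi n"
    unfolding u_def by (rule power_flow_power[OF q])
  moreover have "u \<noteq> 0"
    using power_flow_nonzero[OF q(1)] by (simp add: u_def)
  moreover have "a * (1 + u * m * \<tau>) = u" if "u * (1 - m * \<tau> * a) = a" for a m
  proof -
    have "a * (1 + u * m * \<tau>) = u * (1 - m * \<tau> * a) + u * (m * \<tau> * a)"
      unfolding that by (simp add: algebra_simps)
    then show ?thesis
      by (simp add: algebra_simps)
  qed
  ultimately have pq: "p powi n * (1 + u * of_int n * \<tau>) = u" "q powi n * (1 + u * of_int n * \<tau>) = u" "u \<noteq> 0"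
    by blast+
  then have "1 + u * of_int n * \<tau> \<noteq> 0"
    by auto
  then have "p powi n = q powi n"
    using pq by (simp add: mult_right_cancel[symmetric, of _ "p powi n"])
  then show "p = q"
    using eq unfolding power_flow_def by (simp split: if_splits)
qed

text \<open>Time and initial point vary together, so that one formula serves twice: with constant
  \<open>w\<close> it yields the differential equation, and at time 0 the first-order term of the
  collar parametrization.\<close>

lemma has_field_derivative_power_flow:
  assumes f: "(f has_field_derivative f') (at x)" and w: "(w has_field_derivative w') (at x)"
    and nz: "w x \<noteq> 0" and small: "norm (of_int n * f x * w x powi n) < 1"
  shows "((\<lambda>x. power_flow n (f x) (w x)) has_field_derivative
     power_flow n (f x) (w x) * (w' + f' * w x powi (n + 1)) / (w x * (1 - of_int n * f x * w x powi n))) (at x)"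
proof (cases "n = 0")
  case True
  have "((\<lambda>x. w x * exp (f x)) has_field_derivative
      w x * exp (f x) * (w' + f' * w x powi (n + 1)) / (w x * (1 - of_int n * f x * w x powi n))) (at x)"
    by (rule derivative_eq_intros f w refl)+ (use nz True in \<open>simp add: field_simps\<close>)
  then show ?thesis
    using True by (simp add: power_flow_def)
next
  case False
  define d where "d = 1 - of_int n * f x * w x powi n"
  have "0 < Re d"
    using Re_one_minus_pos[OF small] by (simp add: d_def)
  then have d: "d \<noteq> 0" "d \<notin> \<real>\<^sub>\<le>\<^sub>0"
    by (auto simp: complex_nonpos_Reals_iff)
  have pw: "((\<lambda>x. w x powi n) has_field_derivative of_int n * w x powi (n - 1) * w') (at x)"
    using DERIV_power_int[OF w disjI2[OF nz], of n] by (simp add: mult_ac)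
  have D: "((\<lambda>x. 1 - of_int n * f x * w x powi n) has_field_derivative
      - (of_int n * (f' * w x powi n + f x * (of_int n * w x powi (n - 1) * w')))) (at x)"
    by (rule derivative_eq_intros f pw refl)+ (simp add: algebra_simps)
  have L: "((\<lambda>x. Ln (1 - of_int n * f x * w x powi n)) has_field_derivative
      inverse d * - (of_int n * (f' * w x powi n + f x * (of_int n * w x powi (n - 1) * w')))) (at x)"
    unfolding d_def by (rule DERIV_chain2[OF has_field_derivative_Ln[OF d(2)[unfolded d_def]] D])
  have E: "((\<lambda>x. exp (- Ln (1 - of_int n * f x * w x powi n) / of_int n)) has_field_derivative
      exp (- Ln d / of_int n) * (- (inverse d * - (of_int n * (f' * w x powi n + f x * (of_int n * w x powi (n - 1) * w')))) / of_int n)) (at x)"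
    unfolding d_def
    by (rule derivative_eq_intros DERIV_cdivide[OF DERIV_minus[OF L[unfolded d_def]]] refl)+
  have pw1: "w x powi (n - 1) = w x powi n / w x" "w x powi (n + 1) = w x powi n * w x"
    using nz by (simp_all add: power_int_diff power_int_add)
  have "((\<lambda>x. w x * exp (- Ln (1 - of_int n * f x * w x powi n) / of_int n)) has_field_derivative
      w' * exp (- Ln d / of_int n) + exp (- Ln d / of_int n) * (- (inverse d * - (of_int n * (f' * w x powi n + f x * (of_int n * w x powi (n - 1) * w')))) / of_int n) * w x) (at x)"
    using DERIV_mult[OF w E] by (simp add: d_def)
  moreover have "w' * exp (- Ln d / of_int n) + exp (- Ln d / of_int n) * (- (inverse d * - (of_int n * (f' * w x powi n + f x * (of_int n * w x powi (n - 1) * w')))) / of_int n) * w x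
      = exp (- Ln d / of_int n) * (w' + f' * w x powi (n + 1)) / d"
  proof -
    define Y where "Y = f' * w x powi n + f x * (of_int n * w x powi (n - 1) * w')"
    define e where "e = exp (- Ln d / of_int n)"
    have "- (inverse d * - (of_int n * Y)) / of_int n = Y / d"
      using False d by (simp add: divide_inverse)
    moreover have "w' * d + Y * w x = w' + f' * w x powi (n + 1)"
      using nz unfolding Y_def d_def pw1 by (simp add: algebra_simps)
    moreover have "w' * e + e * (Y / d) * w x = e * (w' * d + Y * w x) / d"
      using d by (simp add: add_divide_distrib distrib_left mult_ac)
    ultimately show ?thesis
      unfolding Y_def e_def by simp
  qed
  ultimately have "((\<lambda>x. w x * exp (- Ln (1 - of_int n * f x * w x powi n) / of_int n)) has_field_derivative
      exp (- Ln d / of_int n) * (w' + f' * w x powi (n + 1)) / d) (at x)"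
    by (rule DERIV_cong)
  moreover have "(\<lambda>x. power_flow n (f x) (w x)) = (\<lambda>x. w x * exp (- Ln (1 - of_int n * f x * w x powi n) / of_int n))"
    using False by (simp add: power_flow_def)
  moreover have "power_flow n (f x) (w x) * (w' + f' * w x powi (n + 1)) / (w x * d)
      = exp (- Ln d / of_int n) * (w' + f' * w x powi (n + 1)) / d"
    using False nz by (simp add: power_flow_def d_def[symmetric])
  ultimately show ?thesis
    unfolding d_def[symmetric] by simp
qed

lemma holomorphic_on_power_flow:
  assumes "f holomorphic_on A" "w holomorphic_on A"
    and "\<And>z. z \<in> A \<Longrightarrow> w z \<noteq> 0 \<and> norm (of_int n * f z * w z powi n) < 1"
  shows "(\<lambda>z. power_flow n (f z) (w z)) holomorphic_on A"
proof (cases "n = 0")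
  case False
  have "(\<lambda>z. w z * exp (- Ln (1 - of_int n * f z * w z powi n) / of_int n)) holomorphic_on A"
  proof (intro holomorphic_intros assms False)
    fix z assume "z \<in> A"
    then have "0 < Re (1 - of_int n * f z * w z powi n)"
      using assms(3) Re_one_minus_pos by blast
    then show "1 - of_int n * f z * w z powi n \<notin> \<real>\<^sub>\<le>\<^sub>0"
      by (auto simp: complex_nonpos_Reals_iff)
  qed (use assms(3) False in auto)
  then show ?thesis
    using False by (simp add: power_flow_def)
qed (use assms in \<open>auto simp: power_flow_def intro!: holomorphic_intros\<close>)

lemma power_flow_has_vector_derivative:
  fixes s :: real
  assumes "p \<noteq> 0" and small: "norm (of_int n * (c * of_real s) * p powi n) < 1"
  shows "((\<lambda>s. power_flow n (c * of_real s) p) has_vector_derivative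
           c * power_flow n (c * of_real s) p powi (n + 1)) (at s within S)"
proof -
  define y where "y = power_flow n (c * of_real s) p"
  define d where "d = 1 - of_int n * (c * of_real s) * p powi n"
  have "((\<lambda>z. power_flow n (c * z) p) has_field_derivative y * (0 + c * p powi (n + 1)) / (p * d)) (at (of_real s))"
    unfolding d_def y_def
    by (rule has_field_derivative_power_flow[where w = "\<lambda>_. p" and w' = 0])
       (use assms in \<open>auto intro!: derivative_eq_intros\<close>)
  moreover have "y * (0 + c * p powi (n + 1)) / (p * d) = c * y powi (n + 1)"
  proof -
    have "d \<noteq> 0"
      unfolding d_def by (rule one_minus_nonzero[OF small])
    have "p powi n = y powi n * d"
      using power_flow_power[OF assms] by (simp add: y_def d_def)
    moreover have "p powi (n + 1) = p powi n * p" "y powi (n + 1) = y powi n * y"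
      using assms(1) power_flow_nonzero[OF assms(1)] by (simp_all add: power_int_add y_def)
    ultimately show ?thesis
      using \<open>d \<noteq> 0\<close> assms(1) by simp
  qed
  ultimately have "((\<lambda>z. power_flow n (c * z) p) has_field_derivative c * y powi (n + 1)) (at (of_real s))"
    by simp
  then show ?thesis
    unfolding y_def by (rule has_vector_derivative_real_field)
qed

lemma has_vector_derivative_zero_unique:
  assumes "convex S" and "\<And>x. x \<in> S \<Longrightarrow> (f has_vector_derivative 0) (at x within S)"
    and "a \<in> S" "b \<in> S"
  shows "f a = f b"
  using assms by (intro has_derivative_zero_unique[of S f]) (auto simp: has_vector_derivative_def)

text \<open>Along every solution u the derivative of \<open>u powi (- n)\<close> is the constant n *
  c, so x and y have equal n-th powers. Then their logarithmic derivatives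
  \<open>- c * x powi n\<close> and \<open>- c * y powi n\<close> agree, and x / y is constant.
  Uniqueness matters because \<open>flow\<close> is a definite description.\<close>

lemma power_integral_curve_unique:
  assumes x: "integral_curve (\<lambda>z. - (c * z powi (n + 1))) x (closed_segment 0 t)"
    and y: "integral_curve (\<lambda>z. - (c * z powi (n + 1))) y (closed_segment 0 t)"
    and eq: "x 0 = y 0"
  shows "x t = y t"
proof -
  let ?I = "closed_segment 0 t"
  have D: "((\<lambda>s. u s powi - n) has_vector_derivative of_int n * c) (at s within ?I)"
    if u: "integral_curve (\<lambda>z. - (c * z powi (n + 1))) u ?I" and s: "s \<in> ?I" for u s
  proof -
    have us: "u s \<noteq> 0" "(u has_vector_derivative - (c * u s powi (n + 1))) (at s within ?I)"
      using u s by (auto simp: integral_curve_def)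
    have "((\<lambda>z. z powi - n) has_field_derivative of_int (- n) * u s powi (- n - 1)) (at (u s))"
      using DERIV_power_int[OF DERIV_ident disjI2[OF us(1)], of "- n"] by simp
    from field_vector_diff_chain_within[OF us(2) has_field_derivative_at_within[OF this]]
    have vd: "((\<lambda>s. u s powi - n) has_vector_derivative
        - (c * u s powi (n + 1)) * (of_int (- n) * u s powi (- n - 1))) (at s within ?I)"
      by (simp add: o_def)
    have "u s powi (n + 1) * u s powi (- n - 1) = 1"
      using us(1) by (simp flip: power_int_add)
    moreover have "- (c * u s powi (n + 1)) * (of_int (- n) * u s powi (- n - 1))
        = of_int n * c * (u s powi (n + 1) * u s powi (- n - 1))"
      by simp
    ultimately have "- (c * u s powi (n + 1)) * (of_int (- n) * u s powi (- n - 1)) = of_int n * c"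
      by simp
    then show ?thesis
      using vd by (simp only:)
  qed
  have pow_eq: "x s powi n = y s powi n" if "s \<in> ?I" for s
  proof -
    have "x s powi - n - y s powi - n = x 0 powi - n - y 0 powi - n"
    proof (rule has_vector_derivative_zero_unique[of ?I])
      show "((\<lambda>s. x s powi - n - y s powi - n) has_vector_derivative 0) (at s within ?I)" if "s \<in> ?I" for s
        using has_vector_derivative_diff[OF D[OF x that] D[OF y that]] by simp
    qed (use that in auto)
    then show ?thesis
      using eq by (simp add: power_int_minus)
  qed
  have "x 0 / y 0 = x t / y t"
  proof (rule has_vector_derivative_zero_unique[of ?I])
    fix s assume s: "s \<in> ?I"
    have xs: "x s \<noteq> 0" "(x has_vector_derivative - (c * x s powi (n + 1))) (at s within ?I)"
      using x s by (auto simp: integral_curve_def)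
    have ys: "y s \<noteq> 0" "(y has_vector_derivative - (c * y s powi (n + 1))) (at s within ?I)"
      using y s by (auto simp: integral_curve_def)
    have "((\<lambda>s. inverse (y s)) has_vector_derivative
        - (c * y s powi (n + 1)) * - (inverse (y s) * inverse (y s))) (at s within ?I)"
      using field_vector_diff_chain_within[OF ys(2) has_field_derivative_at_within[OF DERIV_inverse'[OF DERIV_ident ys(1)]]]
      by (simp add: o_def)
    from has_vector_derivative_mult[OF xs(2) this]
    have "((\<lambda>s. x s / y s) has_vector_derivative
        x s * (- (c * y s powi (n + 1)) * - (inverse (y s) * inverse (y s)))
          + - (c * x s powi (n + 1)) * inverse (y s)) (at s within ?I)"
      by (simp only: divide_inverse)
    moreover have "x s * (- (c * y s powi (n + 1)) * - (inverse (y s) * inverse (y s)))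
          + - (c * x s powi (n + 1)) * inverse (y s) = 0"
      using xs(1) ys(1) pow_eq[OF s] by (simp add: power_int_add)
    ultimately show "((\<lambda>s. x s / y s) has_vector_derivative 0) (at s within ?I)"
      by (simp only:)
  qed auto
  moreover have "y 0 \<noteq> 0" "y t \<noteq> 0"
    using y by (auto simp: integral_curve_def)
  ultimately show ?thesis
    using eq by (simp add: field_simps)
qed

text \<open>The reversed time cancels the minus sign of the field, so points move along
  \<open>c * z powi (n + 1)\<close>. Smallness at time t implies smallness at all intermediate
  times, hence the explicit solution exists on the whole segment.\<close>

lemma flow_power:
  fixes t :: real
  assumes "p \<noteq> 0" and small: "norm (of_int n * (c * of_real t) * p powi n) < 1"
  shows "flow (\<lambda>z. - (c * z powi (n + 1))) (- t) p = power_flow n (c * of_real t) p"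
  unfolding flow_def
proof (rule the_equality)
  let ?x = "\<lambda>s. power_flow n (- c * of_real s) p"
  have "integral_curve (\<lambda>z. - (c * z powi (n + 1))) ?x (closed_segment 0 (- t))"
    unfolding integral_curve_def
  proof (intro ballI conjI)
    fix s assume "s \<in> closed_segment 0 (- t)"
    then have "\<bar>s\<bar> \<le> \<bar>t\<bar>"
      by (auto simp: closed_segment_eq_real_ivl split: if_splits)
    then have "norm (of_int n * (- c * of_real s) * p powi n) \<le> norm (of_int n * (c * of_real t) * p powi n)"
      by (auto simp: norm_mult intro!: mult_left_mono mult_right_mono)
    then have "norm (of_int n * (- c * of_real s) * p powi n) < 1"
      using small by linarith
    then show "(?x has_vector_derivative - (c * ?x s powi (n + 1))) (at s within closed_segment 0 (- t))"
      using power_flow_has_vector_derivative[OF assms(1), of n "- c" s] by simp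
  qed (use assms power_flow_nonzero in auto)
  then show *: "\<exists>x. integral_curve (\<lambda>z. - (c * z powi (n + 1))) x (closed_segment 0 (- t)) \<and>
      x 0 = p \<and> x (- t) = power_flow n (c * of_real t) p"
    by (intro exI[of _ ?x]) auto
  fix q assume "\<exists>x. integral_curve (\<lambda>z. - (c * z powi (n + 1))) x (closed_segment 0 (- t)) \<and>
      x 0 = p \<and> x (- t) = q"
  with * show "q = power_flow n (c * of_real t) p"
    using power_integral_curve_unique by metis
qed

section \<open>Jordan curves and their Riemann maps\<close>

lemma Loop1_closed_path:
  assumes "\<gamma> \<in> Loop1"
  obtains g where "simple_path g" "pathfinish g = pathstart g" "path_image g = \<gamma>"
proof -
  have "\<gamma> homeomorphic sphere (0::complex) 1"
    using assms by (simp add: Loop1_def)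
  then have "sphere (0::complex) 1 homeomorphic \<gamma>"
    by (rule homeomorphic_sym[THEN iffD1])
  then obtain h k where hk: "homeomorphism (sphere (0::complex) 1) \<gamma> h k"
    unfolding homeomorphic_def by (elim exE) (rule that)
  have h: "continuous_on (sphere 0 1) h" "inj_on h (sphere 0 1)" "h ` sphere 0 1 = \<gamma>"
    using hk unfolding homeomorphism_def by (auto intro: inj_on_inverseI)
  have im: "path_image (circlepath 0 1) = sphere 0 1"
    by simp
  show ?thesis
  proof (rule that[of "h \<circ> circlepath 0 1"])
    show "simple_path (h \<circ> circlepath 0 1)"
      by (rule simple_path_continuous_image) (use h im in \<open>auto simp: simple_path_circlepath\<close>)
    show "path_image (h \<circ> circlepath 0 1) = \<gamma>"
      unfolding path_image_compose im by (rule h)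
  qed (simp add: pathfinish_compose pathstart_compose)
qed

lemma Loop1_inside:
  assumes "\<gamma> \<in> Loop1"
  shows "open (inside \<gamma>)" "simply_connected (inside \<gamma>)" "bounded (inside \<gamma>)" "0 \<in> inside \<gamma>"
proof -
  obtain g where g: "simple_path g" "pathfinish g = pathstart g" "path_image g = \<gamma>"
    using Loop1_closed_path[OF assms] .
  show "open (inside \<gamma>)" "simply_connected (inside \<gamma>)" "bounded (inside \<gamma>)"
    using Jordan_inside_outside[OF g(1,2)] simply_connected_inside_simple_path[OF g(1)] g(3) by auto
  show "0 \<in> inside \<gamma>"
    using assms by (simp add: Loop1_def)
qed

text \<open>A Riemann map is corrected by an automorphism of the disc, which brings the preimage of
  0 to 0, and by a rotation, which makes the derivative there positive. Existence is enough, as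
  \<open>phi_plus\<close> is a choice.\<close>

lemma is_phi_plus_phi_plus:
  assumes "\<gamma> \<in> Loop1"
  shows "is_phi_plus \<gamma> (phi_plus \<gamma>)"
proof -
  let ?U = "inside \<gamma>"
  note U = Loop1_inside[OF assms]
  have "?U \<noteq> UNIV"
    using U(3) not_bounded_UNIV by metis
  moreover have "?U \<noteq> {}"
    using U(4) by auto
  moreover have "open ?U \<and> simply_connected ?U"
    using U by simp
  ultimately have "\<exists>f g. f holomorphic_on ?U \<and> g holomorphic_on ball 0 1 \<and>
           (\<forall>z \<in> ?U. f z \<in> ball 0 1 \<and> g (f z) = z) \<and> (\<forall>z \<in> ball 0 1. g z \<in> ?U \<and> f (g z) = z)"
    using Riemann_mapping_theorem[of ?U] by (simp only: simp_thms)
  then obtain f g where fg: "f holomorphic_on ?U" "g holomorphic_on ball 0 1"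
    "\<And>z. z \<in> ?U \<Longrightarrow> f z \<in> ball 0 1" "\<And>z. z \<in> ?U \<Longrightarrow> g (f z) = z"
    "\<And>z. z \<in> ball 0 1 \<Longrightarrow> g z \<in> ?U" "\<And>z. z \<in> ball 0 1 \<Longrightarrow> f (g z) = z"
    by auto
  obtain m k where mk: "m (f 0) = 0" "m holomorphic_on ball 0 1" "m ` ball 0 1 \<subseteq> ball 0 1"
                "k holomorphic_on ball 0 1" "k ` ball 0 1 \<subseteq> ball 0 1"
                "\<And>z. z \<in> ball 0 1 \<Longrightarrow> m (k z) = z" "\<And>z. z \<in> ball 0 1 \<Longrightarrow> k (m z) = z"
    using ball_biholomorphism_exists[OF fg(3)[OF U(4)]] by metis
  define e where "e z = g (k z)" for z
  have "k 0 = f 0"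
    using mk(7)[OF fg(3)[OF U(4)]] mk(1) by simp
  then have e0: "e 0 = 0"
    using fg(4)[OF U(4)] by (simp add: e_def)
  have e_hol: "e holomorphic_on ball 0 1"
    unfolding e_def[abs_def]
    by (rule holomorphic_on_compose_gen[OF mk(4) fg(2) mk(5), unfolded o_def])
  have e_bij: "bij_betw e (ball 0 1) ?U"
  proof (rule bij_betw_byWitness[where f' = "\<lambda>z. m (f z)"])
    show "\<forall>z\<in>ball 0 1. m (f (e z)) = z"
      using mk fg by (auto simp: e_def image_subset_iff)
    show "\<forall>z\<in>?U. e (m (f z)) = z"
      using mk(7) fg by (simp add: e_def)
    show "e ` ball 0 1 \<subseteq> ?U"
      using mk(5) fg(5) by (auto simp: e_def image_subset_iff)
    show "(\<lambda>z. m (f z)) ` ?U \<subseteq> ball 0 1"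
      using mk(3) fg(3) by (auto simp: image_subset_iff)
  qed
  have d: "deriv e 0 \<noteq> 0"
    using holomorphic_injective_imp_regular[OF e_hol open_ball bij_betw_imp_inj_on[OF e_bij], of 0] by simp
  define u where "u = of_real (norm (deriv e 0)) / deriv e 0"
  have u: "norm u = 1"
    using d by (simp add: u_def norm_divide)
  define F where "F z = e (u * z)" for z
  have rot: "bij_betw (\<lambda>z. u * z) (ball 0 1) (ball 0 1)"
    by (rule bij_betw_byWitness[where f' = "\<lambda>z. z / u"]) (use u in \<open>auto simp: norm_mult norm_divide\<close>)
  have "F holomorphic_on ball 0 1"
    unfolding F_def[abs_def]
    by (rule holomorphic_on_compose_gen[OF _ e_hol, unfolded o_def])
       (use u in \<open>auto simp: norm_mult intro!: holomorphic_intros\<close>)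
  moreover have "bij_betw F (ball 0 1) ?U"
    using bij_betw_trans[OF rot e_bij] by (simp add: F_def[abs_def] o_def)
  moreover have "deriv F 0 = of_real (norm (deriv e 0))"
  proof -
    have e': "(e has_field_derivative deriv e 0) (at (u * 0))"
      using holomorphic_derivI[OF e_hol open_ball, of 0] by simp
    have "((\<lambda>z. u * z) has_field_derivative u) (at 0)"
      by (auto intro!: derivative_eq_intros)
    then have "(F has_field_derivative deriv e 0 * u) (at 0)"
      unfolding F_def[abs_def] by (rule DERIV_chain2[where f = e and g = "\<lambda>z. u * z", OF e'])
    moreover have "deriv e 0 * u = of_real (norm (deriv e 0))"
      using d by (simp add: u_def)
    ultimately show ?thesis
      by (simp add: DERIV_imp_deriv)
  qed
  moreover have "F 0 = 0"
    using e0 by (simp add: F_def)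
  ultimately have "is_phi_plus \<gamma> F"
    using d by (simp add: is_phi_plus_def)
  then show ?thesis
    unfolding phi_plus_def by (rule someI[of "is_phi_plus \<gamma>"])
qed

lemma connected_subset_inside:
  fixes S :: "complex set"
  assumes "connected C" "C \<inter> S = {}" "x \<in> C" "x \<in> inside S"
  shows "C \<subseteq> inside S"
proof
  fix y assume "y \<in> C"
  then have "connected_component (- S) x y"
    using assms unfolding connected_component_def by (intro exI[of _ C]) auto
  then show "y \<in> inside S"
    using assms(4) inside_same_component by metis
qed

text \<open>A displacement smaller than the distance to 0 preserves the winding number about 0. It
  has modulus 1 for the original curve, so 0 cannot lie outside the image.\<close>

lemma Loop1_image:
  assumes \<gamma>: "\<gamma> \<in> Loop1" and f: "continuous_on \<gamma> f" "inj_on f \<gamma>"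
    and close: "\<And>p. p \<in> \<gamma> \<Longrightarrow> norm (f p - p) < norm p"
  shows "f ` \<gamma> \<in> Loop1"
proof -
  obtain g where g: "simple_path g" "pathfinish g = pathstart g" "path_image g = \<gamma>"
    using Loop1_closed_path[OF \<gamma>] .
  have g_in: "g t \<in> \<gamma>" if "t \<in> {0..1}" for t
    using that g(3) by (auto simp: path_image_def)
  have sp: "simple_path (f \<circ> g)" and loop: "pathfinish (f \<circ> g) = pathstart (f \<circ> g)" and im: "path_image (f \<circ> g) = f ` \<gamma>"
    using g f by (auto intro!: simple_path_continuous_image simp: pathfinish_compose pathstart_compose path_image_compose)
  have nz: "0 \<notin> f ` \<gamma>"
    using close by fastforce
  have "winding_number (f \<circ> g) 0 = winding_number g 0"
    by (rule winding_number_nearby_loops_eq)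
       (use g sp loop g_in close in \<open>auto simp: simple_path_imp_path\<close>)
  moreover have "norm (winding_number g 0) = 1"
    using simple_closed_path_norm_winding_number_inside[OF g(1), of 0] g Loop1_inside(4)[OF \<gamma>] by simp
  ultimately have "winding_number (f \<circ> g) 0 \<noteq> 0"
    by auto
  then have "0 \<notin> outside (f ` \<gamma>)"
    using winding_number_zero_in_outside[OF simple_path_imp_path[OF sp] loop, of 0] im by auto
  then have "0 \<in> inside (f ` \<gamma>)"
    using nz inside_Un_outside[of "f ` \<gamma>"] by blast
  moreover have "compact (f ` \<gamma>)"
    using f \<gamma> by (intro compact_continuous_image) (auto simp: Loop1_def)
  moreover have "f ` \<gamma> homeomorphic sphere (0::complex) 1"
    using homeomorphic_simple_path_image_circle[OF sp loop, of 1 0] im by simp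
  ultimately show ?thesis
    using nz by (auto simp: Loop1_def)
qed

section \<open>Second-order estimates and small times\<close>

text \<open>Division by the variable is possible twice, h z = z^2 * l z, and the maximum principle
  bounds \<open>l\<close> by its values on the circle of radius r. The constant depends on
  \<open>h\<close> only through \<open>M\<close>, which gives uniformity in parameters.\<close>

lemma norm_le_square_if_deriv_zero:
  assumes hol: "h holomorphic_on ball 0 R" and r: "0 < r" "r < R"
    and M: "\<And>z. norm z < R \<Longrightarrow> norm (h z) \<le> M"
    and h0: "h 0 = 0" "deriv h 0 = 0" and \<tau>: "norm \<tau> \<le> r"
  shows "norm (h \<tau>) \<le> M / r\<^sup>2 * (norm \<tau>)\<^sup>2"
proof -
  obtain k where k: "k holomorphic_on ball 0 R" "\<And>z. norm z < R \<Longrightarrow> h z = z * k z" "deriv h 0 = k 0"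
    by (rule Schwarz3[OF hol h0(1)]) (rule that)
  then have "k 0 = 0"
    using h0 by simp
  obtain l where l: "l holomorphic_on ball 0 R" "\<And>z. norm z < R \<Longrightarrow> k z = z * l z" "deriv k 0 = l 0"
    by (rule Schwarz3[OF k(1) \<open>k 0 = 0\<close>]) (rule that)
  have hl: "h z = z\<^sup>2 * l z" if "norm z < R" for z
    using k(2)[OF that] l(2)[OF that] by (simp add: power2_eq_square)
  have "norm (l \<tau>) \<le> M / r\<^sup>2"
  proof (rule maximum_modulus_frontier[of l "cball 0 r"])
    show "l holomorphic_on interior (cball 0 r)"
      using r by (intro holomorphic_on_subset[OF l(1)]) auto
    have "continuous_on (cball 0 r) l"
      using r by (intro holomorphic_on_imp_continuous_on holomorphic_on_subset[OF l(1)]) auto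
    then show "continuous_on (closure (cball 0 r)) l"
      by simp
    show "norm (l z) \<le> M / r\<^sup>2" if "z \<in> frontier (cball 0 r)" for z
    proof -
      have z: "norm z = r" "norm z < R"
        using that r by auto
      then have "r\<^sup>2 * norm (l z) \<le> M"
        using M[OF z(2)] hl[OF z(2)] by (simp add: norm_mult norm_power)
      then show ?thesis
        using r by (simp add: pos_le_divide_eq mult.commute)
    qed
  qed (use \<tau> in auto)
  then have "(norm \<tau>)\<^sup>2 * norm (l \<tau>) \<le> (norm \<tau>)\<^sup>2 * (M / r\<^sup>2)"
    by (intro mult_left_mono) auto
  then show ?thesis
    using hl[of \<tau>] \<tau> r by (simp add: norm_mult norm_power mult.commute)
qed

lemma power_flow_small_time:
  fixes a b :: real
  assumes "0 < a"
  obtains \<tau>0 where "\<tau>0 > 0"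
    "\<And>\<tau> p. norm \<tau> \<le> \<tau>0 \<Longrightarrow> a \<le> norm p \<Longrightarrow> norm p \<le> b \<Longrightarrow> norm (of_int n * \<tau> * p powi n :: complex) \<le> 1 / 2"
proof (cases "b < a")
  case True
  then show ?thesis
    by (intro that[of 1]) auto
next
  case False
  \<comment> \<open>Powers are monotone in the radius, so this sum of the values at both ends
    dominates for either sign of n.\<close>
  define B where "B = a powi n + b powi n"
  have ab: "a powi n > 0" "b powi n > 0"
    using assms False by auto
  have bound: "norm (p powi n) \<le> B" if "a \<le> norm p" "norm p \<le> b" for p :: complex
  proof (cases "n \<ge> 0")
    case True
    then have "norm p powi n \<le> b powi n"
      using that by (intro power_int_mono) auto
    then show ?thesis
      using ab by (simp add: B_def norm_power_int)
  next
    case False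
    have "norm p powi n = inverse (norm p powi (- n))"
      by (simp add: power_int_minus)
    also have "\<dots> \<le> inverse (a powi (- n))"
      using that assms False by (intro le_imp_inverse_le power_int_mono) auto
    also have "\<dots> = a powi n"
      by (simp add: power_int_minus)
    finally show ?thesis
      using ab by (simp add: B_def norm_power_int)
  qed
  \<comment> \<open>The summand 1 avoids division by 0 when n = 0.\<close>
  define N where "N = \<bar>real_of_int n\<bar> + 1"
  have "N > 0" "B > 0"
    using ab by (auto simp: N_def B_def)
  show ?thesis
  proof (rule that[of "1 / (2 * N * B)"])
    show "1 / (2 * N * B) > 0"
      using \<open>N > 0\<close> \<open>B > 0\<close> by simp
    fix \<tau> p :: complex
    assume *: "norm \<tau> \<le> 1 / (2 * N * B)" "a \<le> norm p" "norm p \<le> b"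
    have "norm (of_int n * \<tau> * p powi n) = \<bar>real_of_int n\<bar> * norm \<tau> * norm (p powi n)"
      by (simp add: norm_mult)
    also have "\<dots> \<le> N * (1 / (2 * N * B)) * B"
      using * bound[of p] \<open>N > 0\<close> \<open>B > 0\<close> by (intro mult_mono) (auto simp: N_def)
    also have "\<dots> = 1 / 2"
      using \<open>N > 0\<close> \<open>B > 0\<close> by simp
    finally show "norm (of_int n * \<tau> * p powi n) \<le> 1 / 2" .
  qed
qed

text \<open>Uniform continuity on the compact product of a disc of times and an annulus of points,
  compared with time 0, where the flow is the identity.\<close>

lemma power_flow_close:
  fixes a b e :: real
  assumes "0 < a" "e > 0"
  obtains \<tau>1 where "\<tau>1 > 0"
    "\<And>\<tau> p. norm \<tau> \<le> \<tau>1 \<Longrightarrow> a \<le> norm p \<Longrightarrow> norm p \<le> b \<Longrightarrow> norm (of_int n * \<tau> * p powi n :: complex) \<le> 1 / 2"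
    "\<And>\<tau> p. norm \<tau> \<le> \<tau>1 \<Longrightarrow> a \<le> norm p \<Longrightarrow> norm p \<le> b \<Longrightarrow> norm (power_flow n \<tau> p - p) < e"
proof -
  obtain \<tau>0 where \<tau>0: "\<tau>0 > 0"
    "\<And>\<tau> p. norm \<tau> \<le> \<tau>0 \<Longrightarrow> a \<le> norm p \<Longrightarrow> norm p \<le> b \<Longrightarrow> norm (of_int n * \<tau> * p powi n :: complex) \<le> 1 / 2"
    by (rule power_flow_small_time[OF assms(1)]) (rule that)
  define K where "K = {p::complex. a \<le> norm p \<and> norm p \<le> b}"
  have "K = cball 0 b \<inter> {p. a \<le> norm p}"
    by (auto simp: K_def)
  moreover have "closed {p::complex. a \<le> norm p}"
    by (intro closed_Collect_le continuous_intros)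
  ultimately have "compact K"
    by (simp add: compact_Int_closed)
  then have cpt: "compact (cball (0::complex) \<tau>0 \<times> K)"
    by (intro compact_Times compact_cball)
  have cont: "continuous_on (cball (0::complex) \<tau>0 \<times> K) (\<lambda>x. power_flow n (fst x) (snd x))"
  proof (cases "n = 0")
    case False
    have "continuous_on (cball (0::complex) \<tau>0 \<times> K)
        (\<lambda>x. snd x * exp (- Ln (1 - of_int n * fst x * snd x powi n) / of_int n))"
    proof (intro continuous_intros ballI)
      fix x assume x: "x \<in> cball (0::complex) \<tau>0 \<times> K"
      then have "norm (of_int n * fst x * snd x powi n) < 1"
        using \<tau>0(2)[of "fst x" "snd x"] by (auto simp: K_def)
      then have "0 < Re (1 - of_int n * fst x * snd x powi n)"
        by (rule Re_one_minus_pos)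
      then show "1 - of_int n * fst x * snd x powi n \<notin> \<real>\<^sub>\<le>\<^sub>0"
        by (auto simp: complex_nonpos_Reals_iff)
    qed (use False assms(1) in \<open>auto simp: K_def\<close>)
    then show ?thesis
      using False by (simp add: power_flow_def)
  qed (auto simp: power_flow_def intro!: continuous_intros)
  have "uniformly_continuous_on (cball (0::complex) \<tau>0 \<times> K) (\<lambda>x. power_flow n (fst x) (snd x))"
    by (rule compact_uniformly_continuous[OF cont cpt])
  then obtain d where d: "d > 0" "\<And>x x'. x \<in> cball (0::complex) \<tau>0 \<times> K \<Longrightarrow> x' \<in> cball (0::complex) \<tau>0 \<times> K \<Longrightarrow> dist x' x < d
      \<Longrightarrow> dist (power_flow n (fst x') (snd x')) (power_flow n (fst x) (snd x)) < e"
    using assms(2) unfolding uniformly_continuous_on_def by meson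
  show ?thesis
  proof (rule that[of "min \<tau>0 (d / 2)"])
    show "min \<tau>0 (d / 2) > 0"
      using \<tau>0 d by simp
    fix \<tau> p :: complex
    assume *: "norm \<tau> \<le> min \<tau>0 (d / 2)" "a \<le> norm p" "norm p \<le> b"
    then show "norm (of_int n * \<tau> * p powi n) \<le> 1 / 2"
      by (intro \<tau>0) auto
    have "dist (\<tau>, p) (0, p) < d"
      using * d(1) by (simp add: dist_Pair_Pair)
    then show "norm (power_flow n \<tau> p - p) < e"
      using d(2)[of "(0, p)" "(\<tau>, p)"] * \<tau>0(1) by (simp add: K_def dist_norm)
  qed
qed

section \<open>Variation of the Riemann map\<close>

text \<open>The radii have separate roles: the derivative is computed on the disc of radius \<rho>0,
  which is also the inner edge of the collar; \<rho>1 and \<rho>2 are the circles of the comparison;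
  \<open>P\<close> is used up to \<rho>3; and \<rho>4 leaves room for the displacement of its
  argument.\<close>

locale loop_variation =
  fixes \<gamma> :: "complex set" and n :: int and c :: complex and \<beta> q :: "complex \<Rightarrow> complex"
    and \<rho>0 \<rho>1 \<rho>2 \<rho>3 \<rho>4 :: real
  assumes \<gamma>: "\<gamma> \<in> Loop1"
    and \<rho>: "0 < \<rho>0" "\<rho>0 < \<rho>1" "\<rho>1 < \<rho>2" "\<rho>2 < \<rho>3" "\<rho>3 < \<rho>4" "\<rho>4 < 1"
    and \<beta>_hol: "\<beta> holomorphic_on ball 0 1" and \<beta>_0: "\<beta> 0 \<in> \<real>"
    and q_hol: "q holomorphic_on - {0}" and q_circle: "\<And>z. norm z = 1 \<Longrightarrow> Re (q z) = 0"
    and \<beta>_eq: "\<And>z. z \<noteq> 0 \<Longrightarrow> norm z < 1 \<Longrightarrow>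
       \<beta> z = q z + c * phi_plus \<gamma> z powi (n + 1) / (z * deriv (phi_plus \<gamma>) z)"
begin

abbreviation \<phi> :: "complex \<Rightarrow> complex" where "\<phi> \<equiv> phi_plus \<gamma>"

lemma \<phi>_hol: "\<phi> holomorphic_on ball 0 1"
  and \<phi>_bij: "bij_betw \<phi> (ball 0 1) (inside \<gamma>)"
  and \<phi>_0: "\<phi> 0 = 0"
  and \<phi>_deriv: "deriv \<phi> 0 \<in> \<real>" "0 < Re (deriv \<phi> 0)"
  using is_phi_plus_phi_plus[OF \<gamma>] unfolding is_phi_plus_def by auto

lemma \<phi>_inj: "inj_on \<phi> (ball 0 1)" and \<phi>_image: "\<phi> ` ball 0 1 = inside \<gamma>"
  using \<phi>_bij by (auto simp: bij_betw_def)

lemma \<phi>_inside: "norm z < 1 \<Longrightarrow> \<phi> z \<in> inside \<gamma>"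
  using \<phi>_image by auto

lemma \<phi>_nonzero:
  assumes "z \<noteq> 0" "norm z < 1"
  shows "\<phi> z \<noteq> 0"
  using inj_onD[OF \<phi>_inj, of z 0] assms \<phi>_0 by auto

lemma \<phi>_has_derivative: "norm z < 1 \<Longrightarrow> (\<phi> has_field_derivative deriv \<phi> z) (at z)"
  by (rule holomorphic_derivI[OF \<phi>_hol open_ball]) simp

lemma deriv_\<phi>_nonzero: "norm z < 1 \<Longrightarrow> deriv \<phi> z \<noteq> 0"
  using holomorphic_injective_imp_regular[OF \<phi>_hol open_ball \<phi>_inj] by simp

lemma q_has_derivative: "z \<noteq> 0 \<Longrightarrow> (q has_field_derivative deriv q z) (at z)"
  by (rule holomorphic_derivI[OF q_hol]) auto

lemma compact_\<gamma>: "compact \<gamma>"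
  using \<gamma> by (simp add: Loop1_def)

lemma inside_disjoint: "z \<in> inside \<gamma> \<Longrightarrow> z \<notin> \<gamma>"
  using inside_no_overlap[of \<gamma>] by blast

text \<open>The image of a disc about 0 contains a disc about 0, which is avoided by the rest of the
  image, by injectivity, and by the curve, which is disjoint from the inside. Squaring \<rho>0
  leaves room for points of the collar to be displaced inwards.\<close>

lemma lower_bound:
  obtains a where "a > 0" "\<And>z. \<rho>0\<^sup>2 \<le> norm z \<Longrightarrow> norm z < 1 \<Longrightarrow> a \<le> norm (\<phi> z)"
    "\<And>p. p \<in> \<gamma> \<Longrightarrow> a \<le> norm p"
proof -
  have r: "0 < \<rho>0\<^sup>2" "\<rho>0\<^sup>2 < 1"
    using \<rho> by (auto simp: power_less_one_iff)
  have sub: "ball 0 (\<rho>0\<^sup>2) \<subseteq> ball (0::complex) 1"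
    using r by auto
  have "open (\<phi> ` ball 0 (\<rho>0\<^sup>2))"
    by (rule open_mapping_thm3[OF holomorphic_on_subset[OF \<phi>_hol sub] open_ball inj_on_subset[OF \<phi>_inj sub]])
  moreover have "0 \<in> \<phi> ` ball 0 (\<rho>0\<^sup>2)"
    using \<phi>_0 r by (intro image_eqI[of _ _ 0]) auto
  ultimately obtain a where a: "a > 0" "ball 0 a \<subseteq> \<phi> ` ball 0 (\<rho>0\<^sup>2)"
    by (meson open_contains_ball)
  show ?thesis
  proof (rule that[OF a(1)])
    fix z :: complex assume z: "\<rho>0\<^sup>2 \<le> norm z" "norm z < 1"
    show "a \<le> norm (\<phi> z)"
    proof (rule ccontr)
      assume "\<not> a \<le> norm (\<phi> z)"
      then have "\<phi> z \<in> \<phi> ` ball 0 (\<rho>0\<^sup>2)"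
        by (intro subsetD[OF a(2)]) simp
      then obtain w where w: "\<phi> z = \<phi> w" "w \<in> ball 0 (\<rho>0\<^sup>2)"
        by (rule imageE)
      have "z = w"
        by (rule inj_onD[OF \<phi>_inj w(1)]) (use z w(2) r in simp_all)
      then show False
        using w(2) z(1) by simp
    qed
  next
    fix p assume p: "p \<in> \<gamma>"
    show "a \<le> norm p"
    proof (rule ccontr)
      assume "\<not> a \<le> norm p"
      then have "p \<in> \<phi> ` ball 0 (\<rho>0\<^sup>2)"
        by (intro subsetD[OF a(2)]) simp
      then have "p \<in> inside \<gamma>"
        using sub \<phi>_image by blast
      then show False
        using p inside_disjoint by blast
    qed
  qed
qed

lemma upper_bound:
  obtains b where "b > 0" "\<And>z. norm z < 1 \<Longrightarrow> norm (\<phi> z) \<le> b" "\<And>p. p \<in> \<gamma> \<Longrightarrow> norm p \<le> b"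
proof -
  have "bounded (inside \<gamma> \<union> \<gamma>)"
    using Loop1_inside(3)[OF \<gamma>] compact_\<gamma> by (simp add: compact_imp_bounded)
  then obtain b where "b > 0" "\<forall>x\<in>inside \<gamma> \<union> \<gamma>. norm x \<le> b"
    by (metis bounded_pos)
  then show ?thesis
    using \<phi>_inside by (intro that[of b]) auto
qed

text \<open>The factor 3 leaves one \<eta> for the displacement of the curve and one for a disc
  about the image point, with a third to spare.\<close>

lemma separation:
  obtains \<eta> where "\<eta> > 0" "\<And>z p. norm z \<le> \<rho>4 \<Longrightarrow> p \<in> \<gamma> \<Longrightarrow> 3 * \<eta> \<le> dist (\<phi> z) p"
proof -
  have sub: "cball 0 \<rho>4 \<subseteq> ball (0::complex) 1"
    using \<rho> by auto
  have "compact (\<phi> ` cball 0 \<rho>4)"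
    by (intro compact_continuous_image compact_cball holomorphic_on_imp_continuous_on holomorphic_on_subset[OF \<phi>_hol sub])
  moreover have "\<phi> ` cball 0 \<rho>4 \<inter> \<gamma> = {}"
    using inside_disjoint \<phi>_inside \<rho> by fastforce
  ultimately obtain d where "d > 0" "\<forall>x\<in>\<phi> ` cball 0 \<rho>4. \<forall>y\<in>\<gamma>. d \<le> dist x y"
    using separate_compact_closed compact_imp_closed[OF compact_\<gamma>] by metis
  then show ?thesis
    by (intro that[of "d / 3"]) auto
qed

lemma coefficient_bound:
  obtains M where "M > 0" "\<And>z. \<rho>0 \<le> norm z \<Longrightarrow> norm z \<le> \<rho>3 \<Longrightarrow> norm (q z) \<le> M"
    "\<And>z. norm z \<le> \<rho>3 \<Longrightarrow> norm (\<beta> z) \<le> M"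
proof -
  have "bounded (\<beta> ` cball 0 \<rho>3)"
    using \<rho> by (intro compact_imp_bounded compact_continuous_image compact_cball
        holomorphic_on_imp_continuous_on holomorphic_on_subset[OF \<beta>_hol]) auto
  moreover have "bounded (q ` (cball 0 \<rho>3 \<inter> {z. \<rho>0 \<le> norm z}))"
    using \<rho> by (intro compact_imp_bounded compact_continuous_image compact_Int_closed compact_cball
        closed_Collect_le continuous_intros holomorphic_on_imp_continuous_on holomorphic_on_subset[OF q_hol]) auto
  ultimately have "bounded (\<beta> ` cball 0 \<rho>3 \<union> q ` (cball 0 \<rho>3 \<inter> {z. \<rho>0 \<le> norm z}))"
    by simp
  then obtain M where "M > 0" "\<forall>x\<in>\<beta> ` cball 0 \<rho>3 \<union> q ` (cball 0 \<rho>3 \<inter> {z. \<rho>0 \<le> norm z}). norm x \<le> M"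
    by (metis bounded_pos)
  then show ?thesis
    by (intro that[of M]) auto
qed

text \<open>The mean value inequality along the radius from z to the circle, where the real part
  vanishes. It makes tangency quantitative: for real times, z * exp (t * q z) changes the logarithm
  of the modulus by at most a multiple of 1 - norm z.\<close>

lemma Re_q_bound:
  obtains C where "C > 0" "\<And>z. \<rho>0 \<le> norm z \<Longrightarrow> norm z < 1 \<Longrightarrow> \<bar>Re (q z)\<bar> \<le> C * (1 - norm z)"
proof -
  have "bounded (deriv q ` (cball 0 1 \<inter> {z. \<rho>0 \<le> norm z}))"
    using \<rho> by (intro compact_imp_bounded compact_continuous_image compact_Int_closed compact_cball
        closed_Collect_le continuous_intros holomorphic_on_imp_continuous_on
        holomorphic_on_subset[OF holomorphic_deriv[OF q_hol]]) auto
  then obtain C where C: "C > 0" "\<And>z. \<rho>0 \<le> norm z \<Longrightarrow> norm z \<le> 1 \<Longrightarrow> norm (deriv q z) \<le> C"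
    by (auto simp: bounded_pos)
  show ?thesis
  proof (rule that[OF C(1)])
    fix z :: complex assume z: "\<rho>0 \<le> norm z" "norm z < 1"
    define w where "w = sgn z"
    have "z \<noteq> 0"
      using z \<rho> by auto
    then have w: "norm w = 1"
      by (simp add: w_def norm_sgn)
    have zw: "z = of_real (norm z) * w"
      using \<open>z \<noteq> 0\<close> by (simp add: w_def sgn_eq)
    have seg: "norm z \<le> norm x \<and> norm x \<le> 1" if x: "x \<in> closed_segment z w" for x
    proof -
      obtain s where s: "0 \<le> s" "s \<le> 1" "x = (1 - s) *\<^sub>R z + s *\<^sub>R w"
        using x by (auto simp: in_segment)
      define r where "r = (1 - s) * norm z + s"
      have "x = (1 - s) *\<^sub>R (of_real (norm z) * w) + s *\<^sub>R w"
        unfolding s(3) by (subst (1) zw) (rule refl)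
      also have "\<dots> = of_real r * w"
        by (simp add: r_def scaleR_conv_of_real algebra_simps)
      finally have "norm x = \<bar>r\<bar>"
        using w by (simp add: norm_mult)
      moreover have "r \<ge> 0"
        using s by (simp add: r_def)
      ultimately have nx: "norm x = (1 - s) * norm z + s"
        by (simp add: r_def)
      have "0 \<le> s * (1 - norm z)" "0 \<le> (1 - s) * (1 - norm z)"
        using s z by auto
      then show ?thesis
        unfolding nx by (simp add: algebra_simps)
    qed
    have "norm (q z - q w) \<le> C * norm (z - w)"
    proof (rule field_differentiable_bound[where S = "closed_segment z w" and f' = "deriv q"])
      fix x assume x: "x \<in> closed_segment z w"
      then have "x \<noteq> 0"
        using seg[OF x] z \<rho> by auto
      then show "(q has_field_derivative deriv q x) (at x within closed_segment z w)"
        using q_has_derivative has_field_derivative_at_within by blast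
      show "norm (deriv q x) \<le> C"
        using seg[OF x] z by (intro C) auto
    qed auto
    moreover have "norm (z - w) = 1 - norm z"
    proof -
      have "z - w = of_real (norm z) * w - w"
        by (subst (1) zw) (rule refl)
      also have "\<dots> = of_real (norm z - 1) * w"
        by (simp add: algebra_simps)
      finally have eq: "z - w = of_real (norm z - 1) * w" .
      have "norm (z - w) = \<bar>norm z - 1\<bar>"
        by (simp only: eq norm_mult norm_of_real w mult_1_right)
      then show ?thesis
        using z by simp
    qed
    moreover have "Re (q z) = Re (q z - q w)"
      using q_circle[OF w] by simp
    ultimately show "\<bar>Re (q z)\<bar> \<le> C * (1 - norm z)"
      using abs_Re_le_cmod[of "q z - q w"] by simp
  qed
qed

end

section \<open>Uniform constants and the two parametrizations\<close>

text \<open>All constants are fixed before the time varies. The bounds on the flow are for complex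
  times, since the comparison of \<open>F\<close> with \<open>P\<close> uses holomorphy in time;
  \<open>T_C\<close> serves real times, for which tangency is effective.\<close>

locale loop_variation_bounds = loop_variation +
  fixes a b \<eta> M C T :: real
  assumes pos: "a > 0" "b > 0" "\<eta> > 0" "M > 0" "C > 0" "T > 0"
    and \<phi>_lower: "\<And>z. \<rho>0\<^sup>2 \<le> norm z \<Longrightarrow> norm z < 1 \<Longrightarrow> a \<le> norm (\<phi> z)"
    and \<gamma>_lower: "\<And>p. p \<in> \<gamma> \<Longrightarrow> a \<le> norm p"
    and \<phi>_upper: "\<And>z. norm z < 1 \<Longrightarrow> norm (\<phi> z) \<le> b"
    and \<gamma>_upper: "\<And>p. p \<in> \<gamma> \<Longrightarrow> norm p \<le> b"
    and sep: "\<And>z p. norm z \<le> \<rho>4 \<Longrightarrow> p \<in> \<gamma> \<Longrightarrow> 3 * \<eta> \<le> dist (\<phi> z) p"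
    and q_bound: "\<And>z. \<rho>0 \<le> norm z \<Longrightarrow> norm z \<le> \<rho>3 \<Longrightarrow> norm (q z) \<le> M"
    and \<beta>_bound: "\<And>z. norm z \<le> \<rho>3 \<Longrightarrow> norm (\<beta> z) \<le> M"
    and Re_q: "\<And>z. \<rho>0 \<le> norm z \<Longrightarrow> norm z < 1 \<Longrightarrow> \<bar>Re (q z)\<bar> \<le> C * (1 - norm z)"
    and T_C: "T * C \<le> 1" and T_M: "exp (T * M) * \<rho>3 \<le> \<rho>4" "\<rho>0 \<le> exp (- (T * M))"
    and T_small: "\<And>\<tau> p. norm \<tau> \<le> T \<Longrightarrow> a \<le> norm p \<Longrightarrow> norm p \<le> b \<Longrightarrow>
        norm (of_int n * (c * \<tau>) * p powi n) \<le> 1 / 2"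
    and T_close: "\<And>\<tau> p. norm \<tau> \<le> T \<Longrightarrow> a \<le> norm p \<Longrightarrow> norm p \<le> b \<Longrightarrow>
        norm (power_flow n (c * \<tau>) p - p) < min \<eta> a"
begin

lemma norm_mult_exp:
  fixes \<tau> w z :: complex
  assumes "norm \<tau> \<le> T" "norm w \<le> M"
  shows "\<rho>0 * norm z \<le> norm (z * exp (\<tau> * w))" "norm (z * exp (\<tau> * w)) \<le> exp (T * M) * norm z"
proof -
  have "\<bar>Re (\<tau> * w)\<bar> \<le> norm \<tau> * norm w"
    using abs_Re_le_cmod[of "\<tau> * w"] by (simp add: norm_mult)
  also have "\<dots> \<le> T * M"
    using assms pos by (intro mult_mono) auto
  finally have *: "\<bar>Re (\<tau> * w)\<bar> \<le> T * M" .
  have "\<rho>0 \<le> exp (Re (\<tau> * w))"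
    using * by (intro order_trans[OF T_M(2)]) auto
  then show "\<rho>0 * norm z \<le> norm (z * exp (\<tau> * w))"
    unfolding norm_mult norm_exp_eq_Re by (subst mult.commute) (intro mult_left_mono, auto)
  have "exp (Re (\<tau> * w)) \<le> exp (T * M)"
    using * by auto
  then show "norm (z * exp (\<tau> * w)) \<le> exp (T * M) * norm z"
    unfolding norm_mult norm_exp_eq_Re by (subst mult.commute) (intro mult_right_mono, auto)
qed

definition P :: "complex \<Rightarrow> complex \<Rightarrow> complex" where
  "P \<tau> z = \<phi> (z * exp (\<tau> * \<beta> z))"

definition F :: "complex \<Rightarrow> complex \<Rightarrow> complex" where
  "F \<tau> z = power_flow n (c * \<tau>) (\<phi> (z * exp (\<tau> * q z)))"

lemma exp_\<beta>_bound:
  assumes "norm \<tau> \<le> T" "norm z \<le> \<rho>3"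
  shows "norm (z * exp (\<tau> * \<beta> z)) \<le> \<rho>4"
proof -
  have "exp (T * M) * norm z \<le> exp (T * M) * \<rho>3"
    using assms by (intro mult_left_mono) auto
  then show ?thesis
    using norm_mult_exp(2)[OF assms(1) \<beta>_bound[OF assms(2)], of z] T_M by linarith
qed

lemma exp_q_bound:
  assumes "norm \<tau> \<le> T" "\<rho>0 \<le> norm z" "norm z \<le> \<rho>3"
  shows "\<rho>0\<^sup>2 \<le> norm (z * exp (\<tau> * q z))" "norm (z * exp (\<tau> * q z)) \<le> \<rho>4"
proof -
  have "exp (T * M) * norm z \<le> exp (T * M) * \<rho>3"
    using assms by (intro mult_left_mono) auto
  then show "norm (z * exp (\<tau> * q z)) \<le> \<rho>4"
    using norm_mult_exp(2)[OF assms(1) q_bound[OF assms(2,3)], of z] T_M by linarith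
  have "\<rho>0 * \<rho>0 \<le> \<rho>0 * norm z"
    using assms \<rho> by (intro mult_left_mono) auto
  then show "\<rho>0\<^sup>2 \<le> norm (z * exp (\<tau> * q z))"
    using norm_mult_exp(1)[OF assms(1) q_bound[OF assms(2,3)], of z] by (simp add: power2_eq_square)
qed

text \<open>For real t only the real part of \<open>q\<close> affects the modulus, whereas for
  complex times its imaginary part would enter. The inequality exp x \<ge> 1 + x gives the lower
  bound; ln r < r - 1 for 0 < r < 1 gives the strict upper one, so the displaced point never reaches
  the circle.\<close>

lemma exp_q_annulus:
  fixes t :: real
  assumes t: "\<bar>t\<bar> \<le> T" and z: "\<rho>0 \<le> norm z" "norm z < 1"
  shows "(norm z)\<^sup>2 \<le> norm (z * exp (of_real t * q z))" "norm (z * exp (of_real t * q z)) < 1"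
proof -
  have "\<bar>Re (of_real t * q z)\<bar> \<le> T * (C * (1 - norm z))"
    using t Re_q[OF z] by (auto simp: abs_mult intro!: mult_mono)
  also have "\<dots> = (T * C) * (1 - norm z)"
    by simp
  also have "\<dots> \<le> 1 - norm z"
    using T_C z pos by (intro mult_left_le_one_le) auto
  finally have *: "\<bar>Re (of_real t * q z)\<bar> \<le> 1 - norm z" .
  have nz: "norm z > 0"
    using z \<rho> by linarith
  have eq: "norm (z * exp (of_real t * q z)) = norm z * exp (Re (of_real t * q z))"
    by (simp add: norm_mult norm_exp_eq_Re)
  have "norm z \<le> 1 + Re (of_real t * q z)"
    using * by linarith
  also have "\<dots> \<le> exp (Re (of_real t * q z))"
    by (rule exp_ge_add_one_self)
  finally show "(norm z)\<^sup>2 \<le> norm (z * exp (of_real t * q z))"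
    unfolding eq power2_eq_square by (intro mult_left_mono) auto
  have "ln (norm z) < norm z - 1"
    using ln_le_minus_one[OF nz] ln_eq_minus_one[OF nz] z by fastforce
  then have "exp (ln (norm z) + Re (of_real t * q z)) < exp 0"
    unfolding exp_less_cancel_iff using * by linarith
  then show "norm (z * exp (of_real t * q z)) < 1"
    unfolding eq using nz by (simp add: exp_add)
qed

lemma flow_image:
  fixes t :: real
  assumes "\<bar>t\<bar> \<le> T"
  shows "flow (\<lambda>z. - (c * z powi (n + 1))) (- t) ` \<gamma> = power_flow n (c * of_real t) ` \<gamma>"
proof (rule image_cong[OF refl])
  fix p assume p: "p \<in> \<gamma>"
  have "norm (of_int n * (c * of_real t) * p powi n) \<le> 1 / 2"
    using assms \<gamma>_lower[OF p] \<gamma>_upper[OF p] by (intro T_small) auto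
  then show "flow (\<lambda>z. - (c * z powi (n + 1))) (- t) p = power_flow n (c * of_real t) p"
    using \<gamma>_lower[OF p] pos by (intro flow_power) auto
qed


text \<open>For complex times, \<open>F \<tau> z - P \<tau> z\<close> is holomorphic in \<open>\<tau>\<close>, bounded, and vanishes to second order at
  \<open>0\<close>, which makes the quadratic bound uniform in \<open>z\<close>.\<close>

lemma F_minus_P_bound:
  assumes \<tau>: "norm \<tau> \<le> T / 2" and z: "\<rho>1 \<le> norm z" "norm z \<le> \<rho>2"
  shows "norm (F \<tau> z - P \<tau> z) \<le> (2 * b + a) / (T / 2)\<^sup>2 * (norm \<tau>)\<^sup>2"
proof (rule norm_le_square_if_deriv_zero[where h = "\<lambda>\<tau>. F \<tau> z - P \<tau> z" and R = T])
  have z': "\<rho>0 \<le> norm z" "norm z \<le> \<rho>3" "norm z < 1" "z \<noteq> 0"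
    using z \<rho> by auto
  define w where "w \<tau> = \<phi> (z * exp (\<tau> * q z))" for \<tau>
  have uq: "\<rho>0\<^sup>2 \<le> norm (z * exp (\<tau> * q z))" "norm (z * exp (\<tau> * q z)) < 1" if "norm \<tau> \<le> T" for \<tau>
    using exp_q_bound[OF that z'(1,2)] \<rho> by auto
  have w_bounds: "a \<le> norm (w \<tau>)" "norm (w \<tau>) \<le> b" if "norm \<tau> \<le> T" for \<tau>
    using \<phi>_lower[OF uq[OF that]] \<phi>_upper[OF uq(2)[OF that]] by (auto simp: w_def)
  have u\<beta>: "norm (z * exp (\<tau> * \<beta> z)) < 1" if "norm \<tau> \<le> T" for \<tau>
    using exp_\<beta>_bound[OF that z'(2)] \<rho> by auto
  have w_hol: "w holomorphic_on ball 0 T"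
    unfolding w_def[abs_def]
    by (rule holomorphic_on_compose_gen[OF _ \<phi>_hol, unfolded o_def])
       (use uq in \<open>auto intro!: holomorphic_intros\<close>)
  have F_eq: "F \<tau> z = power_flow n (c * \<tau>) (w \<tau>)" for \<tau>
    by (simp add: F_def w_def)
  have "(\<lambda>\<tau>. F \<tau> z) holomorphic_on ball 0 T"
    unfolding F_eq
  proof (rule holomorphic_on_power_flow[OF _ w_hol])
    show "w \<tau> \<noteq> 0 \<and> norm (of_int n * (c * \<tau>) * w \<tau> powi n) < 1" if "\<tau> \<in> ball 0 T" for \<tau>
      using T_small[of \<tau> "w \<tau>"] w_bounds[of \<tau>] that pos by auto
  qed (intro holomorphic_intros)
  moreover have "(\<lambda>\<tau>. P \<tau> z) holomorphic_on ball 0 T"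
    unfolding P_def
    by (rule holomorphic_on_compose_gen[OF _ \<phi>_hol, unfolded o_def])
       (use u\<beta> in \<open>auto intro!: holomorphic_intros\<close>)
  ultimately show "(\<lambda>\<tau>. F \<tau> z - P \<tau> z) holomorphic_on ball 0 T"
    by (rule holomorphic_on_diff)
  \<comment> \<open>The flow moves points by less than \<open>a\<close>, so \<open>F\<close> is
    bounded by b + a, and \<open>P\<close> by b.\<close>
  show "norm (F \<tau> z - P \<tau> z) \<le> 2 * b + a" if "norm \<tau> < T" for \<tau>
  proof -
    have "norm (F \<tau> z) \<le> norm (w \<tau>) + norm (F \<tau> z - w \<tau>)"
      by (rule norm_triangle_sub)
    then have "norm (F \<tau> z) \<le> b + a"
      using T_close[of \<tau> "w \<tau>"] w_bounds[of \<tau>] that by (simp add: F_eq)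
    moreover have "norm (P \<tau> z) \<le> b"
      unfolding P_def using u\<beta>[of \<tau>] that by (intro \<phi>_upper) auto
    ultimately show ?thesis
      using norm_triangle_ineq4[of "F \<tau> z" "P \<tau> z"] by linarith
  qed
  show "F 0 z - P 0 z = 0"
    by (simp add: F_def P_def)
  have inner: "((\<lambda>\<tau>. z * exp (\<tau> * v)) has_field_derivative z * v) (at 0)" for v
    by (auto intro!: derivative_eq_intros)
  have \<phi>': "(\<phi> has_field_derivative deriv \<phi> z) (at (z * exp (0 * v)))" for v
    using \<phi>_has_derivative[OF z'(3)] by simp
  have P': "((\<lambda>\<tau>. P \<tau> z) has_field_derivative deriv \<phi> z * (z * \<beta> z)) (at 0)"
    unfolding P_def by (rule DERIV_chain2[where f = \<phi> and g = "\<lambda>\<tau>. z * exp (\<tau> * \<beta> z)", OF \<phi>' inner])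
  have w': "(w has_field_derivative deriv \<phi> z * (z * q z)) (at 0)"
    unfolding w_def[abs_def] by (rule DERIV_chain2[where f = \<phi> and g = "\<lambda>\<tau>. z * exp (\<tau> * q z)", OF \<phi>' inner])
  have f': "((\<lambda>\<tau>. c * \<tau>) has_field_derivative c) (at 0)"
    by (auto intro!: derivative_eq_intros)
  have w0: "w 0 = \<phi> z" "\<phi> z \<noteq> 0"
    using \<phi>_nonzero z' by (auto simp: w_def)
  have "((\<lambda>\<tau>. F \<tau> z) has_field_derivative deriv \<phi> z * (z * q z) + c * \<phi> z powi (n + 1)) (at 0)"
    unfolding F_eq using has_field_derivative_power_flow[OF f' w', of n] w0 by simp
  from DERIV_diff[OF this P']
  have "((\<lambda>\<tau>. F \<tau> z - P \<tau> z) has_field_derivative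
      deriv \<phi> z * (z * q z) + c * \<phi> z powi (n + 1) - deriv \<phi> z * (z * \<beta> z)) (at 0)" .
  \<comment> \<open>First-order agreement is exactly \<open>\<beta>_eq\<close> multiplied by z and
    by the derivative of \<phi>.\<close>
  moreover have "deriv \<phi> z * (z * q z) + c * \<phi> z powi (n + 1) = deriv \<phi> z * (z * \<beta> z)"
    unfolding \<beta>_eq[OF z'(4,3)] using z'(4) deriv_\<phi>_nonzero[OF z'(3)] by (simp add: distrib_left)
  ultimately show "deriv (\<lambda>\<tau>. F \<tau> z - P \<tau> z) 0 = 0"
    by (simp add: DERIV_imp_deriv)
qed (use \<tau> pos in auto)

definition \<gamma>t :: "real \<Rightarrow> complex set" where
  "\<gamma>t t = power_flow n (c * of_real t) ` \<gamma>"

lemma \<gamma>_small: "\<bar>t\<bar> \<le> T \<Longrightarrow> p \<in> \<gamma> \<Longrightarrow> norm (of_int n * (c * of_real t) * p powi n) < 1"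
  using T_small[of "of_real t" p] \<gamma>_lower \<gamma>_upper by fastforce

lemma \<gamma>_close: "\<bar>t\<bar> \<le> T \<Longrightarrow> p \<in> \<gamma> \<Longrightarrow> norm (power_flow n (c * of_real t) p - p) < min \<eta> a"
  using T_close[of "of_real t" p] \<gamma>_lower \<gamma>_upper by simp

lemma \<gamma>t_Loop1:
  assumes t: "\<bar>t\<bar> \<le> T"
  shows "\<gamma>t t \<in> Loop1"
  unfolding \<gamma>t_def
proof (rule Loop1_image[OF \<gamma>])
  have *: "p \<noteq> 0 \<and> norm (of_int n * (c * of_real t) * p powi n) < 1" if "p \<in> \<gamma>" for p
    using \<gamma>_small[OF t that] \<gamma>_lower[OF that] pos by auto
  have "power_flow n (c * of_real t) holomorphic_on \<gamma>"
    by (rule holomorphic_on_power_flow[of "\<lambda>_. c * of_real t" \<gamma> "\<lambda>z. z"]) (use * in \<open>auto intro!: holomorphic_intros\<close>)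
  then show "continuous_on \<gamma> (power_flow n (c * of_real t))"
    by (rule holomorphic_on_imp_continuous_on)
  show "inj_on (power_flow n (c * of_real t)) \<gamma>"
    by (rule inj_on_power_flow[OF *])
  show "norm (power_flow n (c * of_real t) p - p) < norm p" if "p \<in> \<gamma>" for p
    using \<gamma>_close[OF t that] \<gamma>_lower[OF that] by linarith
qed

text \<open>The thickened core \<open>D\<close> is connected and contains 0. The moved curve cannot
  meet it: the thickening and the displacement of the curve are each below \<eta>, against a
  distance of at least 3 * \<eta>.\<close>

lemma core_inside:
  assumes t: "\<bar>t\<bar> \<le> T" and z: "norm z \<le> \<rho>4"
  shows "ball (\<phi> z) \<eta> \<subseteq> inside (\<gamma>t t)"
proof -
  define D where "D = (\<lambda>x. \<phi> (fst x) + snd x) ` (cball 0 \<rho>4 \<times> ball 0 \<eta>)"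
  have sub: "cball 0 \<rho>4 \<subseteq> ball (0::complex) 1"
    using \<rho> by auto
  have "continuous_on (cball 0 \<rho>4) \<phi>"
    by (rule holomorphic_on_imp_continuous_on[OF holomorphic_on_subset[OF \<phi>_hol sub]])
  then have "continuous_on (cball 0 \<rho>4 \<times> ball 0 \<eta>) (\<lambda>x. \<phi> (fst x) + snd x)"
    by (intro continuous_intros continuous_on_compose2[of "cball 0 \<rho>4" \<phi> _ fst]) auto
  then have "connected D"
    unfolding D_def by (intro connected_continuous_image connected_Times connected_cball connected_ball)
  moreover have "D \<inter> \<gamma>t t = {}"
  proof (rule ccontr)
    assume "D \<inter> \<gamma>t t \<noteq> {}"
    then obtain u v p where *: "norm u \<le> \<rho>4" "norm v < \<eta>" "p \<in> \<gamma>" "\<phi> u + v = power_flow n (c * of_real t) p"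
      by (auto simp: D_def \<gamma>t_def)
    have "\<phi> u - p = (power_flow n (c * of_real t) p - p) - v"
      using *(4) by (simp add: algebra_simps flip: *(4))
    then have "dist (\<phi> u) p \<le> norm (power_flow n (c * of_real t) p - p) + norm v"
      unfolding dist_norm by (metis norm_triangle_ineq4)
    then show False
      using \<gamma>_close[OF t *(3)] sep[OF *(1,3)] *(2) pos by linarith
  qed
  moreover have "0 \<in> D"
    unfolding D_def using \<phi>_0 pos \<rho> by (intro image_eqI[of _ _ "(0, 0)"]) auto
  ultimately have "D \<subseteq> inside (\<gamma>t t)"
    using connected_subset_inside[of D "\<gamma>t t" 0] Loop1_inside(4)[OF \<gamma>t_Loop1[OF t]] by blast
  moreover have "ball (\<phi> z) \<eta> \<subseteq> D"
  proof
    fix x assume "x \<in> ball (\<phi> z) \<eta>"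
    then show "x \<in> D"
      unfolding D_def using z by (intro image_eqI[of _ _ "(z, x - \<phi> z)"]) (auto simp: dist_norm norm_minus_commute)
  qed
  ultimately show ?thesis
    by blast
qed

lemma F_holomorphic:
  assumes t: "\<bar>t\<bar> \<le> T"
  shows "F (of_real t) holomorphic_on {z. \<rho>0 < norm z \<and> norm z < 1}"
proof -
  let ?A = "{z::complex. \<rho>0 < norm z \<and> norm z < 1}"
  have u: "norm (z * exp (of_real t * q z)) < 1" "\<rho>0\<^sup>2 \<le> norm (z * exp (of_real t * q z))" if "z \<in> ?A" for z
  proof -
    have z: "\<rho>0 \<le> norm z" "norm z < 1"
      using that by auto
    show "norm (z * exp (of_real t * q z)) < 1"
      by (rule exp_q_annulus(2)[OF t z])
    have "\<rho>0\<^sup>2 \<le> (norm z)\<^sup>2"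
      using z \<rho> by (intro power_mono) auto
    then show "\<rho>0\<^sup>2 \<le> norm (z * exp (of_real t * q z))"
      using exp_q_annulus(1)[OF t z] by linarith
  qed
  have "(\<lambda>z. \<phi> (z * exp (of_real t * q z))) holomorphic_on ?A"
  proof (rule holomorphic_on_compose_gen[OF _ \<phi>_hol, unfolded o_def])
    have "q holomorphic_on ?A"
      using \<rho> by (intro holomorphic_on_subset[OF q_hol]) auto
    then show "(\<lambda>z. z * exp (of_real t * q z)) holomorphic_on ?A"
      by (intro holomorphic_intros)
  qed (use u in auto)
  then show ?thesis
    unfolding F_def[abs_def]
  proof (rule holomorphic_on_power_flow[rotated])
    fix z assume z: "z \<in> ?A"
    show "\<phi> (z * exp (of_real t * q z)) \<noteq> 0 \<and>
        norm (of_int n * (c * of_real t) * \<phi> (z * exp (of_real t * q z)) powi n) < 1"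
      using T_small[of "of_real t" "\<phi> (z * exp (of_real t * q z))"] t pos
        \<phi>_lower[OF u(2,1)[OF z]] \<phi>_upper[OF u(1)[OF z]] by auto
  qed (intro holomorphic_intros)
qed

end

lemma has_vector_derivative_if_close:
  fixes f g :: "real \<Rightarrow> 'a::real_normed_vector"
  assumes g: "(g has_vector_derivative d) (at 0)" and "T > 0"
    and close: "\<And>t. \<bar>t\<bar> < T \<Longrightarrow> norm (g t - f t) \<le> E * t\<^sup>2"
  shows "(f has_vector_derivative d) (at 0)"
proof -
  have eq0: "f 0 = g 0"
    using close[of 0] \<open>T > 0\<close> by simp
  have "((\<lambda>t. f t - g t) has_derivative (\<lambda>_. 0)) (at 0)"
  proof (rule has_derivativeI_sandwich[OF \<open>T > 0\<close>])
    fix t :: real assume t: "t \<noteq> 0" "dist t 0 < T"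
    have "norm (f t - g t) \<le> E * t\<^sup>2"
      using close[of t] t by (simp add: norm_minus_commute)
    then have "norm (f t - g t) / \<bar>t\<bar> \<le> E * t\<^sup>2 / \<bar>t\<bar>"
      by (intro divide_right_mono) auto
    also have "E * t\<^sup>2 / \<bar>t\<bar> = E * \<bar>t\<bar>"
      using t by (simp add: power2_eq_square abs_if)
    finally show "norm (f t - g t - (f 0 - g 0) - 0) / norm (t - 0) \<le> E * \<bar>t\<bar>"
      by (simp add: eq0)
  next
    have "((\<lambda>t::real. E * \<bar>t\<bar>) \<longlongrightarrow> E * \<bar>0\<bar>) (at 0)"
      by (intro tendsto_intros)
    then show "((\<lambda>t. E * \<bar>t\<bar>) \<longlongrightarrow> 0) (at (0::real))"
      by simp
  qed auto
  then have "((\<lambda>t. f t - g t) has_vector_derivative 0) (at 0)"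
    by (simp add: has_vector_derivative_def)
  from has_vector_derivative_add[OF this g] show ?thesis
    by simp
qed

context loop_variation_bounds
begin

lemma \<phi>_exp_q_bounds:
  assumes "\<bar>t\<bar> \<le> T" "\<rho>0 \<le> norm z" "norm z < 1"
  shows "\<phi> (z * exp (of_real t * q z)) \<in> inside \<gamma>"
    "a \<le> norm (\<phi> (z * exp (of_real t * q z)))" "norm (\<phi> (z * exp (of_real t * q z))) \<le> b"
proof -
  have "\<rho>0\<^sup>2 \<le> (norm z)\<^sup>2"
    using assms \<rho> by (intro power_mono) auto
  then show "\<phi> (z * exp (of_real t * q z)) \<in> inside \<gamma>"
    "a \<le> norm (\<phi> (z * exp (of_real t * q z)))" "norm (\<phi> (z * exp (of_real t * q z))) \<le> b"
    using exp_q_annulus[OF assms] by (auto intro!: \<phi>_inside \<phi>_lower \<phi>_upper)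
qed

text \<open>The flow is injective on the closed annulus between the radii \<open>a\<close> and
  \<open>b\<close>, which contains both \<open>p\<close> and the original curve, so a common image
  would put \<open>p\<close> on that curve.\<close>

lemma power_flow_notin_\<gamma>t:
  assumes t: "\<bar>t\<bar> \<le> T" and p: "p \<in> inside \<gamma>" "a \<le> norm p" "norm p \<le> b"
  shows "power_flow n (c * of_real t) p \<notin> \<gamma>t t"
proof
  assume "power_flow n (c * of_real t) p \<in> \<gamma>t t"
  then obtain p' where p': "p' \<in> \<gamma>" "power_flow n (c * of_real t) p = power_flow n (c * of_real t) p'"
    by (auto simp: \<gamma>t_def)
  have "inj_on (power_flow n (c * of_real t)) {p::complex. a \<le> norm p \<and> norm p \<le> b}"
  proof (rule inj_on_power_flow)
    fix p :: complex assume "p \<in> {p. a \<le> norm p \<and> norm p \<le> b}"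
    then show "p \<noteq> 0 \<and> norm (of_int n * (c * of_real t) * p powi n) < 1"
      using T_small[of "of_real t" p] t pos by auto
  qed
  then have "p = p'"
    using p' p \<gamma>_lower \<gamma>_upper by (auto dest: inj_onD)
  then show False
    using p p' inside_disjoint by blast
qed

text \<open>The collar is connected and its image misses the moved curve, so a single point decides
  the side. At \<rho>1 the image is within \<eta> of the core, hence inside.\<close>

lemma F_inside:
  assumes t: "\<bar>t\<bar> \<le> T" and z: "\<rho>0 < norm z" "norm z < 1"
  shows "F (of_real t) z \<in> inside (\<gamma>t t) - {0}"
proof -
  let ?A = "{z::complex. \<rho>0 < norm z \<and> norm z < 1}"
  have "connected ?A"
    using connected_annulus(1)[of \<rho>0 "0::complex" 1] by simp
  then have "connected (F (of_real t) ` ?A)"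
    by (intro connected_continuous_image holomorphic_on_imp_continuous_on F_holomorphic t)
  moreover have "F (of_real t) ` ?A \<inter> \<gamma>t t = {}"
    using power_flow_notin_\<gamma>t[OF t \<phi>_exp_q_bounds[OF t]] by (auto simp: F_def)
  moreover have "F (of_real t) (of_real \<rho>1) \<in> F (of_real t) ` ?A"
    using \<rho> by (intro imageI) auto
  moreover have "F (of_real t) (of_real \<rho>1) \<in> inside (\<gamma>t t)"
  proof -
    define w where "w = of_real \<rho>1 * exp (of_real t * q (of_real \<rho>1))"
    have r1: "\<rho>0 \<le> norm (of_real \<rho>1 :: complex)" "norm (of_real \<rho>1 :: complex) \<le> \<rho>3"
      "norm (of_real \<rho>1 :: complex) < 1"
      using \<rho> by auto
    have "norm (F (of_real t) (of_real \<rho>1) - \<phi> w) < min \<eta> a"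
      unfolding F_def w_def
      using \<phi>_exp_q_bounds[OF t r1(1,3)] t by (intro T_close) auto
    then have "F (of_real t) (of_real \<rho>1) \<in> ball (\<phi> w) \<eta>"
      unfolding mem_ball dist_norm by (subst norm_minus_commute) simp
    moreover have "norm w \<le> \<rho>4"
      unfolding w_def using t by (intro exp_q_bound r1) auto
    ultimately show ?thesis
      using core_inside[OF t, of w] by blast
  qed
  ultimately have "F (of_real t) ` ?A \<subseteq> inside (\<gamma>t t)"
    by (rule connected_subset_inside)
  moreover have "F (of_real t) z \<noteq> 0"
    unfolding F_def using \<phi>_exp_q_bounds(2)[OF t _ z(2)] z pos by (intro power_flow_nonzero) auto
  ultimately show ?thesis
    using z by auto
qed

text \<open>The pullback \<open>R\<close> of \<open>Q\<close> under the flow is compact in the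
  closure of the old domain. It avoids the old curve, whose points go to the moved curve, so its
  preimage under \<phi> lies in a disc of radius r < 1. Continuity up to the curve is used for the
  flow alone, never for \<phi>.\<close>

lemma F_proper:
  assumes t: "\<bar>t\<bar> \<le> T" and Q: "compact Q" "Q \<subseteq> inside (\<gamma>t t)"
  shows "\<exists>\<rho><1. \<forall>z. \<rho> < norm z \<and> norm z < 1 \<longrightarrow> F (of_real t) z \<notin> Q"
proof -
  define K where "K = closure (inside \<gamma>) \<inter> {p. a \<le> norm p \<and> norm p \<le> b}"
  define R where "R = K \<inter> power_flow n (c * of_real t) -` Q"
  have "bounded K"
    unfolding K_def by (rule bounded_subset[OF bounded_cball[of 0 b]]) auto
  moreover have "closed K"
    unfolding K_def by (intro closed_Int closed_closure closed_Collect_conj closed_Collect_le continuous_intros)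
  ultimately have "compact K"
    by (simp add: compact_eq_bounded_closed)
  have "power_flow n (c * of_real t) holomorphic_on K"
  proof (rule holomorphic_on_power_flow[of "\<lambda>_. c * of_real t" K "\<lambda>z. z"])
    fix p assume "p \<in> K"
    then show "p \<noteq> 0 \<and> norm (of_int n * (c * of_real t) * p powi n) < 1"
      using T_small[of "of_real t" p] t pos by (auto simp: K_def)
  qed (intro holomorphic_intros)+
  then have "closed R"
    unfolding R_def
    by (intro continuous_closed_preimage holomorphic_on_imp_continuous_on \<open>closed K\<close> compact_imp_closed Q(1))
  then have "compact R"
    using \<open>bounded K\<close> by (auto simp: compact_eq_bounded_closed R_def intro: bounded_subset)
  have R_inside: "R \<subseteq> inside \<gamma>"
  proof
    fix p assume p: "p \<in> R"
    have "p \<notin> \<gamma>"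
    proof
      assume "p \<in> \<gamma>"
      then have "power_flow n (c * of_real t) p \<in> \<gamma>t t"
        by (auto simp: \<gamma>t_def)
      moreover have "power_flow n (c * of_real t) p \<in> inside (\<gamma>t t)"
        using p Q(2) by (auto simp: R_def)
      ultimately show False
        using inside_no_overlap[of "\<gamma>t t"] by blast
    qed
    moreover have "closure (inside \<gamma>) \<subseteq> inside \<gamma> \<union> \<gamma>"
      using frontier_inside_subset[OF compact_imp_closed[OF compact_\<gamma>]] Loop1_inside(1)[OF \<gamma>]
      by (auto simp: frontier_def interior_open)
    ultimately show "p \<in> inside \<gamma>"
      using p by (auto simp: R_def K_def)
  qed
  obtain g where g: "g holomorphic_on (\<phi> ` ball 0 1)" "\<And>z. z \<in> ball 0 1 \<Longrightarrow> g (\<phi> z) = z"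
    using holomorphic_has_inverse[OF \<phi>_hol open_ball \<phi>_inj] by metis
  have "continuous_on R g"
    using g(1) R_inside unfolding \<phi>_image
    by (intro holomorphic_on_imp_continuous_on) (rule holomorphic_on_subset)
  then have "compact ((\<lambda>p. norm (g p)) ` R)"
    by (intro compact_continuous_image continuous_on_norm \<open>compact R\<close>)
  have gR: "norm (g p) < 1" if p: "p \<in> R" for p
  proof -
    have "p \<in> \<phi> ` ball 0 1"
      using p R_inside \<phi>_image by blast
    then obtain w where w: "p = \<phi> w" "w \<in> ball 0 1"
      by (rule imageE)
    then show ?thesis
      using g(2)[OF w(2)] by simp
  qed
  have "\<exists>r\<ge>0. r < 1 \<and> (\<forall>p\<in>R. norm (g p) \<le> r)"
  proof (cases "R = {}")
    case False
    then have "(\<lambda>p. norm (g p)) ` R \<noteq> {}"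
      by simp
    then obtain x where "x \<in> R" "\<forall>y\<in>R. norm (g y) \<le> norm (g x)"
      using compact_attains_sup[OF \<open>compact ((\<lambda>p. norm (g p)) ` R)\<close>] by auto
    then show ?thesis
      using gR[of x] by (intro exI[of _ "norm (g x)"]) auto
  qed (intro exI[of _ 0], auto)
  then obtain r where r: "0 \<le> r" "r < 1" "\<And>p. p \<in> R \<Longrightarrow> norm (g p) \<le> r"
    by blast
  show ?thesis
  \<comment> \<open>The square root makes up for \<open>exp_q_annulus\<close>, which bounds the
    modulus of the displaced point below by the square of that of z.\<close>
  proof (intro exI[of _ "max \<rho>0 (sqrt r)"] conjI allI impI notI)
    show "max \<rho>0 (sqrt r) < 1"
      using \<rho> r by auto
    fix z :: complex
    assume z: "max \<rho>0 (sqrt r) < norm z \<and> norm z < 1" and FQ: "F (of_real t) z \<in> Q"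
    define w where "w = z * exp (of_real t * q z)"
    have z': "\<rho>0 \<le> norm z" "norm z < 1"
      using z by auto
    have w: "(norm z)\<^sup>2 \<le> norm w" "norm w < 1"
      unfolding w_def by (rule exp_q_annulus[OF t z'])+
    have "\<phi> w \<in> R"
      using FQ \<phi>_exp_q_bounds[OF t z'] closure_subset unfolding R_def K_def F_def w_def by auto
    then have "norm w \<le> r"
      using r(3)[of "\<phi> w"] g(2)[of w] w by simp
    moreover have "(sqrt r)\<^sup>2 < (norm z)\<^sup>2"
      using z r by (intro power_strict_mono) auto
    then have "r < (norm z)\<^sup>2"
      using r by simp
    ultimately show False
      using w by linarith
  qed
qed

lemma P_deriv: "deriv (P (of_real t)) 0 = deriv \<phi> 0 * exp (of_real t * \<beta> 0)"
proof (rule DERIV_imp_deriv)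
  have "(\<beta> has_field_derivative deriv \<beta> 0) (at 0)"
    by (rule holomorphic_derivI[OF \<beta>_hol open_ball]) simp
  then have g': "((\<lambda>z. z * exp (of_real t * \<beta> z)) has_field_derivative exp (of_real t * \<beta> 0)) (at 0)"
    by (auto intro!: derivative_eq_intros)
  have \<phi>': "(\<phi> has_field_derivative deriv \<phi> 0) (at (0 * exp (of_real t * \<beta> 0)))"
    using \<phi>_has_derivative[of 0] by simp
  show "(P (of_real t) has_field_derivative deriv \<phi> 0 * exp (of_real t * \<beta> 0)) (at 0)"
    unfolding P_def[abs_def]
    by (rule DERIV_chain2[where f = \<phi> and g = "\<lambda>z. z * exp (of_real t * \<beta> z)", OF \<phi>' g'])
qed

text \<open>\<delta> is the bound of \<open>F_minus_P_bound\<close> at time t. The comparison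
  requires it to be positive, hence t is nonzero.\<close>

lemma comparison:
  assumes t: "t \<noteq> 0" "\<bar>t\<bar> \<le> T / 2"
    and \<delta>: "\<delta> = (2 * b + a) / (T / 2)\<^sup>2 * t\<^sup>2" "\<delta> \<le> \<eta> / 2" "\<delta> \<le> a / 2"
  shows "disc_comparison (inside (\<gamma>t t)) (phi_plus (\<gamma>t t)) (F (of_real t)) (P (of_real t))
     \<rho>0 \<rho>1 \<rho>2 \<rho>3 (b + a) a \<eta> \<delta>"
proof -
  have tT: "\<bar>t\<bar> \<le> T"
    using t pos by linarith
  have phi: "is_phi_plus (\<gamma>t t) (phi_plus (\<gamma>t t))"
    by (rule is_phi_plus_phi_plus[OF \<gamma>t_Loop1[OF tT]])
  have u: "norm (z * exp (of_real t * \<beta> z)) \<le> \<rho>4" if "norm z < \<rho>3" for z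
    using that tT by (intro exp_\<beta>_bound) auto
  show ?thesis
  proof
    show "0 < \<rho>0" "\<rho>0 < \<rho>1" "\<rho>1 < \<rho>2" "\<rho>2 < \<rho>3" "\<rho>3 < 1" "0 < b + a" "0 < a" "0 < \<eta>"
      using \<rho> pos by auto
    show "0 < \<delta>"
      unfolding \<delta>(1) using pos t by (intro mult_pos_pos divide_pos_pos) auto
    show "\<delta> \<le> \<eta> / 2" "\<delta> \<le> a / 2"
      by fact+
    show "phi_plus (\<gamma>t t) holomorphic_on ball 0 1" "bij_betw (phi_plus (\<gamma>t t)) (ball 0 1) (inside (\<gamma>t t))"
      "phi_plus (\<gamma>t t) 0 = 0" "deriv (phi_plus (\<gamma>t t)) 0 \<in> \<real>" "0 < Re (deriv (phi_plus (\<gamma>t t)) 0)"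
      using phi unfolding is_phi_plus_def by auto
    \<comment> \<open>The moved curve lies in the ball of radius b + a. By convexity the complement
      of this ball is outside the curve, so the inside lies in the ball too.\<close>
    show "norm w < b + a" if "w \<in> inside (\<gamma>t t)" for w
    proof -
      have "\<gamma>t t \<subseteq> ball 0 (b + a)"
      proof
        fix x assume "x \<in> \<gamma>t t"
        then obtain p where p: "p \<in> \<gamma>" "x = power_flow n (c * of_real t) p"
          by (auto simp: \<gamma>t_def)
        have "norm x \<le> norm p + norm (x - p)"
          by (rule norm_triangle_sub)
        then show "x \<in> ball 0 (b + a)"
          using \<gamma>_close[OF tT p(1)] \<gamma>_upper[OF p(1)] p(2) by simp
      qed
      then have "- ball 0 (b + a) \<subseteq> outside (\<gamma>t t)"
        by (intro outside_subset_convex convex_ball)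
      then have "w \<in> ball 0 (b + a)"
        using that inside_Int_outside[of "\<gamma>t t"] by blast
      then show ?thesis
        by simp
    qed
    show "P (of_real t) holomorphic_on ball 0 \<rho>3"
      unfolding P_def[abs_def]
    proof (rule holomorphic_on_compose_gen[OF _ \<phi>_hol, unfolded o_def])
      have "\<beta> holomorphic_on ball 0 \<rho>3"
        using \<rho> by (intro holomorphic_on_subset[OF \<beta>_hol]) auto
      then show "(\<lambda>z. z * exp (of_real t * \<beta> z)) holomorphic_on ball 0 \<rho>3"
        by (intro holomorphic_intros)
      show "(\<lambda>z. z * exp (of_real t * \<beta> z)) ` ball 0 \<rho>3 \<subseteq> ball 0 1"
        using u \<rho> by force
    qed
    show "P (of_real t) 0 = 0"
      by (simp add: P_def \<phi>_0)
    \<comment> \<open>Realness of \<beta> at 0 makes the derivative of \<open>P\<close> at 0 a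
      positive number.\<close>
    obtain A where A: "deriv \<phi> 0 = of_real A"
      using \<phi>_deriv(1) by (rule Reals_cases)
    obtain B where B: "\<beta> 0 = of_real B"
      using \<beta>_0 by (rule Reals_cases)
    have "A > 0"
      using \<phi>_deriv(2) by (simp add: A)
    moreover have "deriv (P (of_real t)) 0 = of_real (A * exp (t * B))"
      by (simp only: P_deriv A B exp_of_real of_real_mult[symmetric])
    ultimately show "deriv (P (of_real t)) 0 \<in> \<real>" "0 < Re (deriv (P (of_real t)) 0)"
      by simp_all
    show "ball (P (of_real t) z) \<eta> \<subseteq> inside (\<gamma>t t)" if "norm z < \<rho>3" for z
      unfolding P_def by (rule core_inside[OF tT u[OF that]])
    show "P (of_real t) z \<noteq> 0" if "0 < norm z" "norm z < \<rho>3" for z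
      unfolding P_def using u[OF that(2)] that \<rho> by (intro \<phi>_nonzero) auto
    show "a \<le> norm (P (of_real t) z)" if z: "\<rho>1 \<le> norm z" "norm z \<le> \<rho>2" for z
    proof -
      have "\<rho>0 * \<rho>0 \<le> \<rho>0 * norm z"
        using z \<rho> by (intro mult_left_mono) auto
      also have "\<dots> \<le> norm (z * exp (of_real t * \<beta> z))"
        using z \<rho> tT by (intro norm_mult_exp \<beta>_bound) auto
      finally show ?thesis
        unfolding P_def using u[of z] z \<rho> by (intro \<phi>_lower) (auto simp: power2_eq_square)
    qed
    show "F (of_real t) holomorphic_on {z. \<rho>0 < norm z \<and> norm z < 1}"
      by (rule F_holomorphic[OF tT])
    show "F (of_real t) z \<in> inside (\<gamma>t t) - {0}" if "\<rho>0 < norm z" "norm z < 1" for z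
      by (rule F_inside[OF tT that])
    show "\<exists>\<rho><1. \<forall>z. \<rho> < norm z \<and> norm z < 1 \<longrightarrow> F (of_real t) z \<notin> Q"
      if "compact Q" "Q \<subseteq> inside (\<gamma>t t)" for Q
      by (rule F_proper[OF tT that])
    show "norm (F (of_real t) z - P (of_real t) z) \<le> \<delta>" if "norm z = \<rho>1 \<or> norm z = \<rho>2" for z
      using F_minus_P_bound[of "of_real t" z] that \<rho> t by (auto simp: \<delta>)
  qed
qed

text \<open>Within the comparison only \<delta> = D * t^2 depends on the time; its other constants
  are fixed, so the quadratic order of the error survives.\<close>

lemma phi_plus_has_vector_derivative:
  assumes z: "norm z \<le> \<rho>0"
  shows "((\<lambda>t. phi_plus (flow (\<lambda>z. - (c * z powi (n + 1))) (- t) ` \<gamma>) z) has_vector_derivative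
      deriv \<phi> z * (z * \<beta> z)) (at 0)"
proof -
  define D where "D = (2 * b + a) / (T / 2)\<^sup>2"
  define G where "G = comparison_const (b + a) a \<eta> \<rho>0 \<rho>1 \<rho>2"
  define E where "E = 3 * (b + a) * G / (1 - \<rho>1) * D"
  have "D > 0"
    using pos by (simp add: D_def)
  have "((\<lambda>t. D * t\<^sup>2) \<longlongrightarrow> D * 0\<^sup>2) (at 0)" "((\<lambda>t. 3 * G * (D * t\<^sup>2)) \<longlongrightarrow> 3 * G * (D * 0\<^sup>2)) (at (0::real))"
    by (intro tendsto_intros)+
  then have lim: "((\<lambda>t. D * t\<^sup>2) \<longlongrightarrow> 0) (at 0)" "((\<lambda>t. 3 * G * (D * t\<^sup>2)) \<longlongrightarrow> 0) (at (0::real))"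
    by simp_all
  have "\<forall>\<^sub>F t in at 0. D * t\<^sup>2 < min (\<eta> / 2) (a / 2)"
    by (rule order_tendstoD(2)[OF lim(1)]) (use pos in simp)
  moreover have "\<forall>\<^sub>F t in at (0::real). 3 * G * (D * t\<^sup>2) < \<rho>1 - \<rho>0"
    by (rule order_tendstoD(2)[OF lim(2)]) (use \<rho> in simp)
  ultimately have "\<forall>\<^sub>F t in at 0. D * t\<^sup>2 < min (\<eta> / 2) (a / 2) \<and> 3 * G * (D * t\<^sup>2) < \<rho>1 - \<rho>0"
    by (rule eventually_conj)
  then obtain d where d: "d > 0" "\<And>t. t \<noteq> 0 \<Longrightarrow> \<bar>t\<bar> < d \<Longrightarrow> D * t\<^sup>2 < min (\<eta> / 2) (a / 2) \<and> 3 * G * (D * t\<^sup>2) < \<rho>1 - \<rho>0"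
    unfolding eventually_at by (auto simp: dist_real_def)
  define T' where "T' = min d (T / 2)"
  have "T' > 0"
    using d pos by (simp add: T'_def)
  have close: "norm (P (of_real t) z - phi_plus (flow (\<lambda>z. - (c * z powi (n + 1))) (- t) ` \<gamma>) z) \<le> E * t\<^sup>2"
    if t: "\<bar>t\<bar> < T'" for t
  proof (cases "t = 0")
    \<comment> \<open>At time 0 the comparison does not apply, since \<delta> would be 0, but both
      terms equal \<phi> z.\<close>
    case True
    have "flow (\<lambda>z. - (c * z powi (n + 1))) (- 0) ` \<gamma> = \<gamma>"
      using flow_image[of 0] pos by simp
    then show ?thesis
      using True by (simp add: P_def)
  next
    case False
    have t': "\<bar>t\<bar> \<le> T / 2" "\<bar>t\<bar> \<le> T" "\<bar>t\<bar> < d"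
      using t pos by (auto simp: T'_def)
    interpret disc_comparison "inside (\<gamma>t t)" "phi_plus (\<gamma>t t)" "F (of_real t)" "P (of_real t)"
      \<rho>0 \<rho>1 \<rho>2 \<rho>3 "b + a" a \<eta> "D * t\<^sup>2"
      by (rule comparison[OF False t'(1)]) (use d(2)[OF False t'(3)] in \<open>auto simp: D_def\<close>)
    have "norm (P (of_real t) z - phi_plus (\<gamma>t t) z) \<le> 3 * (b + a) * G / (1 - \<rho>1) * (D * t\<^sup>2)"
      unfolding G_def by (rule norm_P_minus_\<Phi>_le) (use d(2)[OF False t'(3)] z in \<open>auto simp: G_def\<close>)
    then show ?thesis
      unfolding flow_image[OF t'(2)] by (simp add: \<gamma>t_def E_def mult.assoc)
  qed
  have z1: "norm z < 1"
    using z \<rho> by linarith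
  have \<phi>': "(\<phi> has_field_derivative deriv \<phi> z) (at (z * exp (0 * \<beta> z)))"
    using \<phi>_has_derivative[OF z1] by simp
  have g': "((\<lambda>\<tau>. z * exp (\<tau> * \<beta> z)) has_field_derivative z * \<beta> z) (at 0)"
    by (auto intro!: derivative_eq_intros)
  have "((\<lambda>\<tau>. P \<tau> z) has_field_derivative deriv \<phi> z * (z * \<beta> z)) (at (of_real 0))"
    unfolding P_def of_real_0 by (rule DERIV_chain2[where f = \<phi> and g = "\<lambda>\<tau>. z * exp (\<tau> * \<beta> z)", OF \<phi>' g'])
  then have "((\<lambda>t. P (of_real t) z) has_vector_derivative deriv \<phi> z * (z * \<beta> z)) (at 0)"
    by (rule has_vector_derivative_real_field)
  then show ?thesis
    using \<open>T' > 0\<close> close by (rule has_vector_derivative_if_close)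
qed

end

context loop_variation
begin

lemma phi_plus_has_vector_derivative:
  assumes z: "norm z \<le> \<rho>0"
  shows "((\<lambda>t. phi_plus (flow (\<lambda>z. - (c * z powi (n + 1))) (- t) ` \<gamma>) z) has_vector_derivative
      deriv \<phi> z * (z * \<beta> z)) (at 0)"
proof -
  obtain a where a: "a > 0" "\<And>z. \<rho>0\<^sup>2 \<le> norm z \<Longrightarrow> norm z < 1 \<Longrightarrow> a \<le> norm (\<phi> z)"
    "\<And>p. p \<in> \<gamma> \<Longrightarrow> a \<le> norm p"
    using lower_bound by metis
  obtain b where b: "b > 0" "\<And>z. norm z < 1 \<Longrightarrow> norm (\<phi> z) \<le> b" "\<And>p. p \<in> \<gamma> \<Longrightarrow> norm p \<le> b"
    using upper_bound by metis
  obtain \<eta> where \<eta>: "\<eta> > 0" "\<And>z p. norm z \<le> \<rho>4 \<Longrightarrow> p \<in> \<gamma> \<Longrightarrow> 3 * \<eta> \<le> dist (\<phi> z) p"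
    using separation by metis
  obtain M where M: "M > 0" "\<And>z. \<rho>0 \<le> norm z \<Longrightarrow> norm z \<le> \<rho>3 \<Longrightarrow> norm (q z) \<le> M"
    "\<And>z. norm z \<le> \<rho>3 \<Longrightarrow> norm (\<beta> z) \<le> M"
    using coefficient_bound by metis
  obtain C where C: "C > 0" "\<And>z. \<rho>0 \<le> norm z \<Longrightarrow> norm z < 1 \<Longrightarrow> \<bar>Re (q z)\<bar> \<le> C * (1 - norm z)"
    using Re_q_bound by metis
  have "min \<eta> a > 0"
    using \<eta> a by simp
  then obtain \<tau>1 where \<tau>1: "\<tau>1 > 0"
    "\<And>\<tau> p. norm \<tau> \<le> \<tau>1 \<Longrightarrow> a \<le> norm p \<Longrightarrow> norm p \<le> b \<Longrightarrow> norm (of_int n * \<tau> * p powi n :: complex) \<le> 1 / 2"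
    "\<And>\<tau> p. norm \<tau> \<le> \<tau>1 \<Longrightarrow> a \<le> norm p \<Longrightarrow> norm p \<le> b \<Longrightarrow> norm (power_flow n \<tau> p - p) < min \<eta> a"
    using power_flow_close[OF a(1), of "min \<eta> a" b n] by metis
  \<comment> \<open>The four terms serve, in this order, the flow bounds at time c * \<tau>, the
    condition \<open>T_C\<close>, and the two parts of \<open>T_M\<close>. The summand 1 avoids
    division by 0 when c = 0.\<close>
  define T where "T = min (min (\<tau>1 / (norm c + 1)) (1 / C)) (min (ln (\<rho>4 / \<rho>3) / M) (- ln \<rho>0 / M))"
  have c1: "norm c + 1 > 0"
    using norm_ge_zero[of c] by linarith
  have ln_pos: "ln (\<rho>4 / \<rho>3) > 0" "- ln \<rho>0 > 0"
    using \<rho> by auto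
  have "T > 0"
    unfolding T_def min_less_iff_conj using \<tau>1(1) c1 C(1) M(1) ln_pos
    by (intro conjI divide_pos_pos) auto
  have T: "T \<le> \<tau>1 / (norm c + 1)" "T \<le> 1 / C" "T \<le> ln (\<rho>4 / \<rho>3) / M" "T \<le> - ln \<rho>0 / M"
    by (simp_all add: T_def)
  have c\<tau>: "norm (c * \<tau>) \<le> \<tau>1" if "norm \<tau> \<le> T" for \<tau>
  proof -
    have "norm (c * \<tau>) \<le> (norm c + 1) * (\<tau>1 / (norm c + 1))"
      unfolding norm_mult using that T(1) c1 by (intro mult_mono) auto
    then show ?thesis
      using c1 by simp
  qed
  interpret loop_variation_bounds \<gamma> n c \<beta> q \<rho>0 \<rho>1 \<rho>2 \<rho>3 \<rho>4 a b \<eta> M C T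
  proof
    show "T * C \<le> 1"
      using T(2) C(1) by (simp add: pos_le_divide_eq)
    have "T * M \<le> ln (\<rho>4 / \<rho>3)"
      using T(3) M(1) by (simp add: pos_le_divide_eq)
    then have "exp (T * M) \<le> exp (ln (\<rho>4 / \<rho>3))"
      by simp
    also have "\<dots> = \<rho>4 / \<rho>3"
      using \<rho> by (intro exp_ln divide_pos_pos) auto
    finally show "exp (T * M) * \<rho>3 \<le> \<rho>4"
      using \<rho> by (simp add: pos_le_divide_eq)
    have "T * M \<le> - ln \<rho>0"
      using T(4) M(1) by (simp only: pos_le_divide_eq)
    then have "exp (ln \<rho>0) \<le> exp (- (T * M))"
      unfolding exp_le_cancel_iff by linarith
    then show "\<rho>0 \<le> exp (- (T * M))"
      using \<rho> by simp
    show "norm (of_int n * (c * \<tau>) * p powi n) \<le> 1 / 2"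
      if "norm \<tau> \<le> T" "a \<le> norm p" "norm p \<le> b" for \<tau> p :: complex
      by (rule \<tau>1(2)[OF c\<tau>[OF that(1)] that(2,3)])
    show "norm (power_flow n (c * \<tau>) p - p) < min \<eta> a"
      if "norm \<tau> \<le> T" "a \<le> norm p" "norm p \<le> b" for \<tau> p
      by (rule \<tau>1(3)[OF c\<tau>[OF that(1)] that(2,3)])
  qed (use a b \<eta> M C \<open>T > 0\<close> in auto)
  show ?thesis
    by (rule phi_plus_has_vector_derivative[OF z])
qed

end

text \<open>The radii are chosen after \<open>z\<close>, so estimates on compact subdiscs reach
  every point of the disc.\<close>

lemma phi_plus_variation:
  assumes \<gamma>: "\<gamma> \<in> Loop1"
    and \<beta>: "\<beta> holomorphic_on ball 0 1" "\<beta> 0 \<in> \<real>"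
    and q: "q holomorphic_on - {0}" "\<And>z. norm z = 1 \<Longrightarrow> Re (q z) = 0"
    and eq: "\<And>z. z \<noteq> 0 \<Longrightarrow> norm z < 1 \<Longrightarrow>
       \<beta> z = q z + c * phi_plus \<gamma> z powi (n + 1) / (z * deriv (phi_plus \<gamma>) z)"
    and z: "norm z < 1"
  shows "((\<lambda>t. phi_plus (flow (\<lambda>z. - (c * z powi (n + 1))) (- t) ` \<gamma>) z) has_vector_derivative
      deriv (phi_plus \<gamma>) z * (z * \<beta> z)) (at 0)"
proof -
  obtain \<rho>0 where \<rho>0: "norm z < \<rho>0" "\<rho>0 < 1"
    using dense[OF z] by auto
  obtain \<rho>1 where \<rho>1: "\<rho>0 < \<rho>1" "\<rho>1 < 1"
    using dense[OF \<rho>0(2)] by auto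
  obtain \<rho>2 where \<rho>2: "\<rho>1 < \<rho>2" "\<rho>2 < 1"
    using dense[OF \<rho>1(2)] by auto
  obtain \<rho>3 where \<rho>3: "\<rho>2 < \<rho>3" "\<rho>3 < 1"
    using dense[OF \<rho>2(2)] by auto
  obtain \<rho>4 where \<rho>4: "\<rho>3 < \<rho>4" "\<rho>4 < 1"
    using dense[OF \<rho>3(2)] by auto
  have "0 < \<rho>0"
    by (rule le_less_trans[OF norm_ge_zero \<rho>0(1)])
  interpret loop_variation \<gamma> n c \<beta> q \<rho>0 \<rho>1 \<rho>2 \<rho>3 \<rho>4
    by unfold_locales (fact assms \<open>0 < \<rho>0\<close> \<rho>1 \<rho>2 \<rho>3 \<rho>4 | rule eq; assumption)+
  show ?thesis
    by (rule phi_plus_has_vector_derivative) (use \<rho>0 in simp)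
qed

section \<open>Laurent coefficients and the explicit formula\<close>

text \<open>The constant term is kept with the principal part because the field is divided by z
  before it enters an exponent: f z / z is then a sum of negative powers plus the holomorphic
  \<open>V\<close>, obtained from a removable singularity.\<close>

lemma principal_part_decomposition:
  assumes hol: "f holomorphic_on ball 0 r - {0}" and "r > 0" and L: "f has_laurent_expansion L"
    and m: "\<And>k. k < m \<Longrightarrow> fls_nth L k = 0"
  obtains V where "V holomorphic_on ball 0 r" "V 0 = fls_nth L 1"
    "\<And>z. z \<noteq> 0 \<Longrightarrow> norm z < r \<Longrightarrow> f z = (\<Sum>k\<in>{m..0}. fls_nth L k * z powi k) + z * V z"
proof -
  define g where "g z = (f z - (\<Sum>k\<in>{m..0}. fls_nth L k * z powi k)) * z powi (-1)" for z
  define G where "G = fls_shift 1 (L - (\<Sum>k\<in>{m..0}. fls_const (fls_nth L k) * fls_X_intpow k))"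
  have "g has_laurent_expansion G"
    unfolding g_def[abs_def] G_def by (intro laurent_expansion_intros L)
  have nth: "fls_nth G j = (if 0 \<le> j then fls_nth L (j + 1) else 0)" for j
  proof -
    have "fls_nth (\<Sum>k\<in>{m..0}. fls_const (fls_nth L k) * fls_X_intpow k) (j + 1)
        = (\<Sum>k\<in>{m..0}. if k = j + 1 then fls_nth L k else 0)"
      unfolding fls_nth_sum by (intro sum.cong refl) auto
    then have "fls_nth G j = fls_nth L (j + 1) - (\<Sum>k\<in>{m..0}. if k = j + 1 then fls_nth L k else 0)"
      by (simp only: G_def fls_shift_nth fls_minus_nth)
    also have "(\<Sum>k\<in>{m..0}. if k = j + 1 then fls_nth L k else 0)
        = (if j + 1 \<in> {m..0} then fls_nth L (j + 1) else 0)"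
      by simp
    finally show ?thesis
      using m[of "j + 1"] by auto
  qed
  have "fls_subdegree G \<ge> 0"
    by (cases "G = 0") (auto simp: nth intro!: fls_subdegree_geI)
  then have lim: "g \<midarrow>0\<rightarrow> fls_nth L 1"
    using has_laurent_expansion_imp_tendsto_0[OF \<open>g has_laurent_expansion G\<close>] nth[of 0] by simp
  define V where "V z = (if z = 0 then fls_nth L 1 else g z)" for z
  have "g holomorphic_on ball 0 r - {0}"
    unfolding g_def[abs_def] by (intro holomorphic_intros hol) auto
  then have V_hol: "V holomorphic_on ball 0 r - {0}"
    by (rule holomorphic_transform) (auto simp: V_def)
  have V_0: "V 0 = fls_nth L 1"
    by (simp add: V_def)
  have "(V \<longlongrightarrow> V 0) (at 0)"
    unfolding V_0 by (rule Lim_transform_eventually[OF lim]) (auto simp: V_def eventually_at_filter)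
  then have "(V \<longlongrightarrow> V 0) (at 0 within ball 0 r)"
    by (rule tendsto_within_subset) simp
  then have "V holomorphic_on ball 0 r"
    using V_hol by (intro no_isolated_singularity'[of "{0}" V "ball 0 r"]) auto
  then show ?thesis
  proof (rule that)
    fix z :: complex assume "z \<noteq> 0" "norm z < r"
    then show "f z = (\<Sum>k\<in>{m..0}. fls_nth L k * z powi k) + z * V z"
      by (simp add: V_def g_def divide_inverse[symmetric])
  qed (simp add: V_def)
qed

lemma laurent_coeffs_eq: "f has_laurent_expansion L \<Longrightarrow> laurent_coeffs f = fls_nth L"
  by (simp add: laurent_coeffs_def laurent_expansion_0_eqI)

text \<open>The factor with exponent - 2 followed by the star sends index k to 2 - k, so positive
  indices come from k \<le> 1 and finitely many terms remain. The term k = 1 stands apart because it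
  is the one halved in the final formula.\<close>

lemma laurent_eval_pos_part_star:
  assumes f: "f has_laurent_expansion L" and m: "\<And>k. k < m \<Longrightarrow> fls_nth L k = 0"
  shows "laurent_eval (pos_part (laurent_star (laurent_coeffs (\<lambda>w. w powi (-2) * f w)))) z
    = (\<Sum>k\<in>{m..0}. cnj (fls_nth L k) * z powi (2 - k)) + cnj (fls_nth L 1) * z"
proof -
  have "(\<lambda>w. f w * w powi (-2)) has_laurent_expansion fls_shift 2 L"
    using has_laurent_expansion_shift[OF f, of "-2"] by simp
  then have "(\<lambda>w. w powi (-2) * f w) has_laurent_expansion fls_shift 2 L"
    by (simp add: mult.commute)
  then have coeffs: "laurent_coeffs (\<lambda>w. w powi (-2) * f w) k = fls_nth L (k + 2)" for k
    by (simp add: laurent_coeffs_eq)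
  define h where "h k = pos_part (laurent_star (laurent_coeffs (\<lambda>w. w powi (-2) * f w))) k * z powi k" for k
  have h: "h k = (if k > 0 then cnj (fls_nth L (2 - k)) * z powi k else 0)" for k
    unfolding h_def pos_part_def laurent_star_def coeffs by simp
  have "infsum h UNIV = infsum h ((\<lambda>k. 2 - k) ` {m..1})"
  proof (rule infsum_cong_neutral)
    fix k assume k: "k \<in> UNIV - (\<lambda>k. 2 - k) ` {m..1}"
    have "k \<le> 0 \<or> 2 - k < m"
    proof (rule ccontr)
      assume "\<not> (k \<le> 0 \<or> 2 - k < m)"
      then have "k \<in> (\<lambda>k. 2 - k) ` {m..1}"
        by (intro image_eqI[of _ _ "2 - k"]) auto
      then show False
        using k by blast
    qed
    then show "h k = 0"
      using m[of "2 - k"] by (auto simp: h)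
  qed auto
  also have "\<dots> = (\<Sum>k\<in>(\<lambda>k. 2 - k) ` {m..1}. h k)"
    by (intro infsum_finite) auto
  also have "\<dots> = (\<Sum>k\<in>{m..1}. h (2 - k))"
    by (subst sum.reindex) (auto simp: inj_on_def)
  also have "\<dots> = (\<Sum>k\<in>{m..1}. cnj (fls_nth L k) * z powi (2 - k))"
    by (intro sum.cong) (auto simp: h)
  also have "\<dots> = (\<Sum>k\<in>{m..0}. cnj (fls_nth L k) * z powi (2 - k)) + cnj (fls_nth L 1) * z"
  proof (cases "m \<le> 1")
    case True
    then have "{m..1} = insert 1 {m..0}"
      by auto
    then show ?thesis
      by simp
  next
    case False
    then show ?thesis
      using m[of 1] by simp
  qed
  finally show ?thesis
    by (simp only: laurent_eval_def h_def[abs_def])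
qed

lemma cnj_power_int: "cnj (z powi k) = cnj z powi k"
  by (simp add: power_int_def)

text \<open>With \<open>c\<close> kept general the derivative displays a linear part, a
  conjugate-linear part and a rotation, which the values 1 and \<i> of \<open>c\<close> later
  separate.\<close>

lemma phi_plus_variation_power:
  assumes \<gamma>: "\<gamma> \<in> Loop1"
    and L: "(\<lambda>w. phi_plus \<gamma> w powi (n + 1) / deriv (phi_plus \<gamma>) w) has_laurent_expansion L"
    and m: "\<And>k. k < m \<Longrightarrow> fls_nth L k = 0"
    and V_hol: "V holomorphic_on ball 0 1" and V_0: "V 0 = fls_nth L 1"
    and V: "\<And>z. z \<noteq> 0 \<Longrightarrow> norm z < 1 \<Longrightarrow> phi_plus \<gamma> z powi (n + 1) / deriv (phi_plus \<gamma>) z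
         = (\<Sum>k\<in>{m..0}. fls_nth L k * z powi k) + z * V z"
    and z: "norm z < 1"
  shows "((\<lambda>t. phi_plus (flow (\<lambda>z. - (c * z powi (n + 1))) (- t) ` \<gamma>) z) has_vector_derivative
      deriv (phi_plus \<gamma>) z * (c * (z * V z) + cnj c * (\<Sum>k\<in>{m..0}. cnj (fls_nth L k) * z powi (2 - k))
        - \<i> * of_real (Im (c * fls_nth L 1)) * z)) (at 0)"
proof -
  \<comment> \<open>Each term of index k \<le> 0 is subtracted and its reflection in the circle
    added; on the circle the two are conjugate, so the difference is purely imaginary. The reflected
    exponents 1 - k are positive and do not affect \<beta> at 0, where the imaginary constant leaves
    the real part of \<open>c * fls_nth L 1\<close>.\<close>
  define q where "q w = (\<Sum>k\<in>{m..0}. cnj (c * fls_nth L k) * w powi (1 - k) - c * fls_nth L k * w powi (k - 1))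
      - \<i> * of_real (Im (c * fls_nth L 1))" for w
  define \<beta> where "\<beta> w = c * V w + (\<Sum>k\<in>{m..0}. cnj (c * fls_nth L k) * w powi (1 - k))
      - \<i> * of_real (Im (c * fls_nth L 1))" for w
  have "((\<lambda>t. phi_plus (flow (\<lambda>z. - (c * z powi (n + 1))) (- t) ` \<gamma>) z) has_vector_derivative
      deriv (phi_plus \<gamma>) z * (z * \<beta> z)) (at 0)"
  proof (rule phi_plus_variation[OF \<gamma>, where q = q])
    show "\<beta> holomorphic_on ball 0 1"
      unfolding \<beta>_def[abs_def] by (intro holomorphic_intros V_hol) auto
    have "\<beta> 0 = c * fls_nth L 1 - \<i> * of_real (Im (c * fls_nth L 1))"
      by (simp add: \<beta>_def V_0)
    also have "\<dots> = of_real (Re (c * fls_nth L 1))"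
      by (simp add: complex_eq_iff)
    finally show "\<beta> 0 \<in> \<real>"
      by simp
    show "q holomorphic_on - {0}"
      unfolding q_def[abs_def] by (intro holomorphic_intros) auto
    show "Re (q w) = 0" if w: "norm w = 1" for w
    proof -
      have "w * cnj w = 1"
        using complex_norm_square[of w] w by simp
      then have cnj_w: "cnj w = inverse w"
        by (rule inverse_unique[symmetric])
      have "cnj (w powi (k - 1)) = w powi (1 - k)" for k
        unfolding cnj_power_int cnj_w power_int_inverse power_int_minus[symmetric] by simp
      then have "cnj (c * fls_nth L k) * w powi (1 - k) = cnj (c * fls_nth L k * w powi (k - 1))" for k
        by simp
      then have "Re (cnj (c * fls_nth L k) * w powi (1 - k) - c * fls_nth L k * w powi (k - 1)) = 0" for k
        by (simp only: minus_complex.sel cnj.sel diff_self)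
      then have "(\<Sum>k\<in>{m..0}. Re (cnj (c * fls_nth L k) * w powi (1 - k) - c * fls_nth L k * w powi (k - 1))) = 0"
        by (simp only: sum.neutral_const)
      then show ?thesis
        unfolding q_def minus_complex.sel(1) Re_sum by simp
    qed
    show "\<beta> w = q w + c * phi_plus \<gamma> w powi (n + 1) / (w * deriv (phi_plus \<gamma>) w)"
      if w: "w \<noteq> 0" "norm w < 1" for w
    proof -
      have "c * phi_plus \<gamma> w powi (n + 1) / (w * deriv (phi_plus \<gamma>) w)
          = c * (phi_plus \<gamma> w powi (n + 1) / deriv (phi_plus \<gamma>) w) / w"
        by simp
      also have "\<dots> = (\<Sum>k\<in>{m..0}. c * (fls_nth L k * w powi k) / w) + c * V w"
        unfolding V[OF w] using w(1) by (simp add: distrib_left add_divide_distrib sum_distrib_left sum_divide_distrib)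
      also have "(\<Sum>k\<in>{m..0}. c * (fls_nth L k * w powi k) / w) = (\<Sum>k\<in>{m..0}. c * fls_nth L k * w powi (k - 1))"
        using w(1) by (intro sum.cong refl) (simp add: power_int_diff)
      finally show ?thesis
        by (simp add: \<beta>_def q_def sum_subtractf)
    qed
  qed (rule z)
  moreover have "z * \<beta> z = c * (z * V z) + cnj c * (\<Sum>k\<in>{m..0}. cnj (fls_nth L k) * z powi (2 - k))
        - \<i> * of_real (Im (c * fls_nth L 1)) * z"
  proof -
    have "z * (cnj (c * fls_nth L k) * z powi (1 - k)) = cnj c * (cnj (fls_nth L k) * z powi (2 - k))"
      if "k \<in> {m..0}" for k
    proof -
      have "z powi (2 - k) = z powi ((1 - k) + 1)"
        by simp
      also have "\<dots> = z powi (1 - k) * z"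
        using that by (subst power_int_add) auto
      finally show ?thesis
        by simp
    qed
    then have "z * (\<Sum>k\<in>{m..0}. cnj (c * fls_nth L k) * z powi (1 - k))
        = cnj c * (\<Sum>k\<in>{m..0}. cnj (fls_nth L k) * z powi (2 - k))"
      unfolding sum_distrib_left by (intro sum.cong refl)
    then show ?thesis
      unfolding \<beta>_def right_diff_distrib distrib_left by (simp add: mult_ac)
  qed
  ultimately show ?thesis
    by simp
qed

theorem theorem4p8:
  fixes n :: int and \<gamma> :: "complex set" and z :: complex
  assumes "\<gamma> \<in> Loop1" and "z \<in> ball 0 1"
  shows "pi0_differentiable (vf_L n) (\<lambda>\<gamma>'. phi_plus \<gamma>' z) \<gamma> \<and>
         pi0_differentiable (vf_iL n) (\<lambda>\<gamma>'. phi_plus \<gamma>' z) \<gamma> \<and>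
         L_bar n (\<lambda>\<gamma>'. phi_plus \<gamma>' z) \<gamma> =
           deriv (phi_plus \<gamma>) z *
             (laurent_eval (pos_part (laurent_star (laurent_coeffs
                (\<lambda>w. w powi (-2) * (phi_plus \<gamma> w powi (n + 1) / deriv (phi_plus \<gamma>) w))))) z
              - 1 / 2 * z * cnj (laurent_coeffs
                  (\<lambda>w. phi_plus \<gamma> w powi (n + 1) / deriv (phi_plus \<gamma>) w) 1))"
proof -
  let ?\<phi> = "phi_plus \<gamma>"
  let ?W = "\<lambda>w. ?\<phi> w powi (n + 1) / deriv ?\<phi> w"
  have \<phi>: "?\<phi> holomorphic_on ball 0 1" "inj_on ?\<phi> (ball 0 1)" "?\<phi> 0 = 0"
    using is_phi_plus_phi_plus[OF assms(1)] by (auto simp: is_phi_plus_def bij_betw_def)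
  have \<phi>': "deriv ?\<phi> holomorphic_on ball 0 1"
    by (rule holomorphic_deriv[OF \<phi>(1) open_ball])
  have nz: "deriv ?\<phi> w \<noteq> 0" "w \<noteq> 0 \<Longrightarrow> ?\<phi> w \<noteq> 0" if "norm w < 1" for w
    using holomorphic_injective_imp_regular[OF \<phi>(1) open_ball \<phi>(2), of w] inj_onD[OF \<phi>(2), of w 0] \<phi>(3) that
    by auto
  have W_hol: "?W holomorphic_on ball 0 1 - {0}"
    by (intro holomorphic_intros holomorphic_on_subset[OF \<phi>(1)] holomorphic_on_subset[OF \<phi>']) (use nz in auto)
  obtain A where A: "?\<phi> has_laurent_expansion A"
    using has_laurent_expansion_fps[OF has_fps_expansion_fps_expansion[OF open_ball _ \<phi>(1)]] by auto
  obtain B where B: "deriv ?\<phi> has_laurent_expansion B"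
    using has_laurent_expansion_fps[OF has_fps_expansion_fps_expansion[OF open_ball _ \<phi>']] by auto
  obtain L where L: "?W has_laurent_expansion L"
    using has_laurent_expansion_divide[OF has_laurent_expansion_power_int[OF A] B] by blast
  define m where "m = fls_subdegree L"
  have m: "fls_nth L k = 0" if "k < m" for k
    using that by (simp add: m_def)
  obtain V where V: "V holomorphic_on ball 0 1" "V 0 = fls_nth L 1"
    "\<And>z. z \<noteq> 0 \<Longrightarrow> norm z < 1 \<Longrightarrow> ?W z = (\<Sum>k\<in>{m..0}. fls_nth L k * z powi k) + z * V z"
    by (rule principal_part_decomposition[OF W_hol zero_less_one L m], assumption) (rule that)
  define S where "S = (\<Sum>k\<in>{m..0}. cnj (fls_nth L k) * z powi (2 - k))"
  define l where "l = fls_nth L 1"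
  have z: "norm z < 1"
    using assms(2) by simp
  note D = phi_plus_variation_power[OF assms(1) L m V z, folded S_def l_def]
  have v: "vf_L n = (\<lambda>z. - (1 * z powi (n + 1)))" "vf_iL n = (\<lambda>z. - (\<i> * z powi (n + 1)))"
    by (simp_all add: vf_L_def vf_iL_def fun_eq_iff)
  have d1: "((\<lambda>t. phi_plus (flow (vf_L n) (- t) ` \<gamma>) z) has_vector_derivative
      deriv ?\<phi> z * (z * V z + S - \<i> * of_real (Im l) * z)) (at 0)"
    using D[of 1] unfolding v by simp
  have d2: "((\<lambda>t. phi_plus (flow (vf_iL n) (- t) ` \<gamma>) z) has_vector_derivative
      deriv ?\<phi> z * (\<i> * (z * V z) - \<i> * S - \<i> * of_real (Re l) * z)) (at 0)"
    using D[of \<i>] unfolding v by simp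
  \<comment> \<open>The factor \<i> on the second derivative cancels the linear part with
    \<open>V\<close>, doubles \<open>S\<close>, and merges the two rotation terms into the conjugate
    of \<open>l\<close>.\<close>
  have "L_bar n (\<lambda>\<gamma>'. phi_plus \<gamma>' z) \<gamma> = deriv ?\<phi> z * (S + cnj l * z / 2)"
  proof -
    have "L_bar n (\<lambda>\<gamma>'. phi_plus \<gamma>' z) \<gamma> =
      (deriv ?\<phi> z * (z * V z + S - \<i> * of_real (Im l) * z)
        + \<i> * (deriv ?\<phi> z * (\<i> * (z * V z) - \<i> * S - \<i> * of_real (Re l) * z))) / 2"
      unfolding L_bar_def pi0_def by (simp only: vector_derivative_at[OF d1] vector_derivative_at[OF d2])
    also have "\<dots> = deriv ?\<phi> z * ((z * V z + S - \<i> * of_real (Im l) * z)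
        + \<i> * (\<i> * (z * V z) - \<i> * S - \<i> * of_real (Re l) * z)) / 2"
      by (simp only: distrib_left mult.left_commute)
    also have "(z * V z + S - \<i> * of_real (Im l) * z) + \<i> * (\<i> * (z * V z) - \<i> * S - \<i> * of_real (Re l) * z)
        = 2 * S + (of_real (Re l) - \<i> * of_real (Im l)) * z"
      by (simp add: algebra_simps)
    also have "deriv ?\<phi> z * (2 * S + (of_real (Re l) - \<i> * of_real (Im l)) * z) / 2
        = deriv ?\<phi> z * (S + (of_real (Re l) - \<i> * of_real (Im l)) * z / 2)"
      by (simp add: distrib_left add_divide_distrib)
    also have "of_real (Re l) - \<i> * of_real (Im l) = cnj l"
      by (simp add: complex_eq_iff)
    finally show ?thesis .
  qed
  \<comment> \<open>The polynomial contains the full term \<open>cnj l * z\<close>; subtracting half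
    of it leaves the value found above.\<close>
  moreover have "laurent_eval (pos_part (laurent_star (laurent_coeffs (\<lambda>w. w powi (-2) * ?W w)))) z = S + cnj l * z"
    unfolding S_def l_def by (rule laurent_eval_pos_part_star[OF L m])
  moreover have "laurent_coeffs ?W 1 = l"
    unfolding l_def laurent_coeffs_eq[OF L] by (rule refl)
  ultimately show ?thesis
    unfolding pi0_differentiable_def
    using differentiableI_vector[OF d1] differentiableI_vector[OF d2] by (simp add: algebra_simps)
qed

end
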